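(* Let $r\ge 3$ be an integer that is not a multiple of $4$, let $V_r=\{0,1,\dots,r-1\}$, and let $\xi=wj^\infty\in V_r^\infty$, where $w$ is a finite word over $V_r$ and $j\in V_r$. Then the horofunction boundary $\partial_h\Gamma_\xi^{(r)}$ has exactly two Busemann points and contains countably many (i.e. a countably infinite set of) non-Busemann points.
   Context: Fix an integer $r\ge 3$ not divisible by $4$; letters of $V_r=\{0,\dots,r-1\}$ are read modulo $r$. Put $f(r)=\min\{i : 4i>r\}$ and $\widetilde f(r)=2f(r)$. Finite Sierpinski graphs. $\Gamma_1^{(r)}$ is the cycle graph $P_r$ on the vertex set $V_r$, with $i$ adjacent to $i\pm1$ mod $r$. For $k\ge2$, $\Gamma_k^{(r)}$ is obtained from $r$ copies of $\Gamma_{k-1}^{(r)}$, numbered $0,\dots,r-1$, where the vertex labelled $v$ of the $i$-th copy receives the label $vi$ (the letter $i$ is appended on the right), by identifying, for every $i\in V_r$, the vertex $(i+f(r))^{k-1}\,i$ of copy $i$ with the vertex $((i+1)+\widetilde f(r))^{k-1}\,(i+1)$ of copy $i+1$ (letters mod $r$; $a^{k-1}$ is the word $a\cdots a$ of length $k-1$). Thus every word of length $k$ over $V_r$ labels a vertex of $\Gamma_k^{(r)}$ (a vertex may have several labels). For example, for $r=6$ one has $f(6)=2$ and $\widetilde f(6)=4$, and in $\Gamma_3^{(6)}$ the vertex $004$ is identified with $335$, and $115$ with $440$. All graphs carry the path metric $\mathrm{d}$ with edges of length $1$. Limit graphs. A sequence of pointed graphs $(X_m,p_m)$ strongly converges in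 the Gromov-Hausdorff sense to a pointed graph $(X,p)$ if for every $R>0$ there is $M(R)>0$ such that for every $m>M(R)$ there is an isometry between the balls $B_{X_m}(p_m,R)$ and $B_X(p,R)$ sending $p_m$ to $p$. For $\xi=x_1x_2\cdots\in V_r^\infty$ let $\xi[k]=x_1\cdots x_k$. The pointed graph $(\Gamma_\xi^{(r)},\xi)$ is the limit, in this sense, of the pointed graphs $(\Gamma_k^{(r)},\xi[k])$ as $k\to\infty$. The sequence $wj^\infty$ is the word $w$ followed by $jjj\cdots$. Horofunctions. Let $X$ be a locally finite connected graph with path metric $\mathrm{d}$, identified with its vertex set, and fix a base vertex $x_0\in X$. Let $C(X,\mathbb{Z})=\mathbb{Z}^X$ have the product topology ($\mathbb{Z}$ discrete). For $v\in X$ put $\overline{\mathrm{d}}_v(x)=\mathrm{d}(x,v)-\mathrm{d}(x_0,v)$ for $x\in X$, and let $\iota:X\to C(X,\mathbb{Z})$, $\iota(v)=\overline{\mathrm{d}}_v$. The horofunction boundary is $\partial_hX=\overline{\iota(X)}\setminus\iota(X)$; its elements are called horofunctions. Busemann points. Let $T\subseteq\mathbb{N}$ be unbounded with $0\in T$, and let $\gamma:T\to X$ be a map to vertices with $\mathrm{d}(\gamma(t),\gamma(0))=t$ for all $t\in T$. Then $\gamma$ is an almost-geodesic ray if there is an integer $N$ such that for all $t,s\in T$ with $t\ge s\ge N$ one has $|\mathrm{d}(\gamma(t),\gamma(s))+\mathrm{d}(\gamma(s),\gamma(0))-t|=0$. A horofunction is a Busemann point if it is the pointwise limit $\lim_{t\to\infty}\overline{\mathrm{d}}_{\gamma(t)}$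 for some almost-geodesic ray $\gamma$; otherwise it is a non-Busemann point. *)

theory Defs
  imports "HOL-Analysis.Analysis" "HOL-Library.Stream"
begin

section \<open>Graphs and the path metric\<close>

record 'v graph =
  verts :: "'v set"
  edges :: "('v \<times> 'v) set"

text \<open>Connected simple graphs, with every undirected edge stored in both orientations.\<close>

definition connected_graph :: "'v graph \<Rightarrow> bool" where
  "connected_graph G \<longleftrightarrow>
     verts G \<noteq> {} \<and> edges G \<subseteq> verts G \<times> verts G \<and> sym (edges G) \<and> irrefl (edges G) \<and>
     (\<forall>u\<in>verts G. \<forall>v\<in>verts G. (u, v) \<in> (edges G)\<^sup>*)"

text \<open>The least length of a path; the value is meaningful only if some path exists.\<close>

definition gdist :: "'v graph \<Rightarrow> 'v \<Rightarrow> 'v \<Rightarrow> nat" where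
  "gdist G u v = (LEAST n. (u, v) \<in> edges G ^^ n)"

definition gball :: "'v graph \<Rightarrow> 'v \<Rightarrow> real \<Rightarrow> 'v set" where
  "gball G p R = {v \<in> verts G. real (gdist G p v) \<le> R}"


section \<open>Strong convergence of pointed graphs\<close>

text \<open>The isometries between balls refer to the metrics restricted from the ambient graphs,
  not to intrinsic path metrics of the balls.\<close>

definition strong_GH_limit ::
  "(nat \<Rightarrow> 'a graph) \<Rightarrow> (nat \<Rightarrow> 'a) \<Rightarrow> 'b graph \<Rightarrow> 'b \<Rightarrow> bool" where
  "strong_GH_limit X p Y q \<longleftrightarrow>
     (\<forall>R::real. R > 0 \<longrightarrow> (\<exists>M>0. \<forall>m>M. \<exists>\<phi>.
        bij_betw \<phi> (gball (X m) (p m) R) (gball Y q R) \<and>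
        (\<forall>u\<in>gball (X m) (p m) R. \<forall>v\<in>gball (X m) (p m) R.
           gdist Y (\<phi> u) (\<phi> v) = gdist (X m) u v) \<and>
        \<phi> (p m) = q))"


section \<open>Finite Sierpinski graphs\<close>

definition fshift :: "nat \<Rightarrow> nat" where
  "fshift r = (LEAST i. 4 * i > r)"

definition fshift2 :: "nat \<Rightarrow> nat" where
  "fshift2 r = 2 * fshift r"

definition sierp_words :: "nat \<Rightarrow> nat \<Rightarrow> nat list set" where
  "sierp_words r k = {u. length u = k \<and> set u \<subseteq> {..<r}}"

text \<open>Two words are related iff they label the same vertex. Related words have the same length;
  on words of length \<open>k\<close> this is the equivalence relation generated by the identifications made
  inside the copies (rule \<open>copy\<close>) and the new ones made between consecutive copies
  (rule \<open>glue\<close>, where \<open>n\<close> is the length of the words of the previous level).\<close>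

inductive_set same_vertex :: "nat \<Rightarrow> (nat list \<times> nat list) set" for r :: nat where
  refl: "set u \<subseteq> {..<r} \<Longrightarrow> (u, u) \<in> same_vertex r"
| sym: "(u, v) \<in> same_vertex r \<Longrightarrow> (v, u) \<in> same_vertex r"
| trans: "(u, v) \<in> same_vertex r \<Longrightarrow> (v, w) \<in> same_vertex r \<Longrightarrow> (u, w) \<in> same_vertex r"
| copy: "(u, v) \<in> same_vertex r \<Longrightarrow> i < r \<Longrightarrow> (u @ [i], v @ [i]) \<in> same_vertex r"
| glue: "n \<ge> 1 \<Longrightarrow> i < r \<Longrightarrow>
    (replicate n ((i + fshift r) mod r) @ [i],
     replicate n ((i + 1 + fshift2 r) mod r) @ [(i + 1) mod r]) \<in> same_vertex r"

text \<open>The edges of the cycle, and their images in the iterated copies, before passing to the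
  quotient by \<^term>\<open>same_vertex\<close>.\<close>

inductive_set word_edges :: "nat \<Rightarrow> (nat list \<times> nat list) set" for r :: nat where
  cycle_succ: "i < r \<Longrightarrow> ([i], [(i + 1) mod r]) \<in> word_edges r"
| cycle_pred: "i < r \<Longrightarrow> ([(i + 1) mod r], [i]) \<in> word_edges r"
| copy: "(u, v) \<in> word_edges r \<Longrightarrow> i < r \<Longrightarrow> (u @ [i], v @ [i]) \<in> word_edges r"

text \<open>The vertex with label \<open>u\<close>, as the set of all its labels.\<close>

definition sierp_vertex :: "nat \<Rightarrow> nat list \<Rightarrow> nat list set" where
  "sierp_vertex r u = same_vertex r `` {u}"

text \<open>Only \<open>k \<ge> 1\<close> is meaningful; at level \<open>0\<close> this is a single vertex without edges.\<close>

definition sierp_graph :: "nat \<Rightarrow> nat \<Rightarrow> nat list set graph" where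
  "sierp_graph r k =
     \<lparr>verts = sierp_words r k // same_vertex r,
      edges = {(sierp_vertex r u, sierp_vertex r v) | u v. (u, v) \<in> word_edges r \<and> length u = k}\<rparr>"

text \<open>\<open>(X, p)\<close> is a model of the pointed limit graph of the infinite word \<open>\<xi>\<close>. The limit is
  determined up to pointed isometry only, so this is a predicate on pointed graphs with an
  arbitrary type of vertices.\<close>

definition is_sierp_limit :: "nat \<Rightarrow> nat stream \<Rightarrow> 'v graph \<Rightarrow> 'v \<Rightarrow> bool" where
  "is_sierp_limit r \<xi> X p \<longleftrightarrow>
     connected_graph X \<and> p \<in> verts X \<and>
     strong_GH_limit (sierp_graph r) (\<lambda>k. sierp_vertex r (stake k \<xi>)) X p"


section \<open>Horofunctions and Busemann points\<close>

text \<open>Integer-valued functions on the vertex set are elements of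
  \<^term>\<open>verts G \<rightarrow>\<^sub>E (UNIV :: int set)\<close>, so they are \<open>undefined\<close> outside \<^term>\<open>verts G\<close>.\<close>

definition dbar :: "'v graph \<Rightarrow> 'v \<Rightarrow> 'v \<Rightarrow> 'v \<Rightarrow> int" where
  "dbar G x0 v = (\<lambda>x\<in>verts G. int (gdist G x v) - int (gdist G x0 v))"

definition horoboundary :: "'v graph \<Rightarrow> 'v \<Rightarrow> ('v \<Rightarrow> int) set" where
  "horoboundary G x0 =
     (product_topology (\<lambda>_. discrete_topology (UNIV :: int set)) (verts G))
       closure_of (dbar G x0 ` verts G) - dbar G x0 ` verts G"

definition almost_geodesic_ray :: "'v graph \<Rightarrow> nat set \<Rightarrow> (nat \<Rightarrow> 'v) \<Rightarrow> bool" where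
  "almost_geodesic_ray G T \<gamma> \<longleftrightarrow>
     \<not> bdd_above T \<and> 0 \<in> T \<and> \<gamma> ` T \<subseteq> verts G \<and>
     (\<forall>t\<in>T. gdist G (\<gamma> t) (\<gamma> 0) = t) \<and>
     (\<exists>N::int. \<forall>t\<in>T. \<forall>s\<in>T. t \<ge> s \<and> int s \<ge> N \<longrightarrow>
        \<bar>int (gdist G (\<gamma> t) (\<gamma> s)) + int (gdist G (\<gamma> s) (\<gamma> 0)) - int t\<bar> = 0)"

text \<open>The filter \<^term>\<open>inf at_top (principal T)\<close> expresses that \<open>t\<close> tends to infinity
  within \<open>T\<close>.\<close>

definition busemann_points :: "'v graph \<Rightarrow> 'v \<Rightarrow> ('v \<Rightarrow> int) set" where
  "busemann_points G x0 =
     {h \<in> horoboundary G x0. \<exists>T \<gamma>. almost_geodesic_ray G T \<gamma> \<and>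
        (\<forall>x\<in>verts G. ((\<lambda>t. dbar G x0 (\<gamma> t) x) \<longlongrightarrow> h x) (inf at_top (principal T)))}"

definition non_busemann_points :: "'v graph \<Rightarrow> 'v \<Rightarrow> ('v \<Rightarrow> int) set" where
  "non_busemann_points G x0 = horoboundary G x0 - busemann_points G x0"

end

theory Submission
  imports Defs
begin

text \<open>
For \<open>\<xi> = wj\<^sup>\<infinity>\<close> the limit graph is the increasing union of finite graphs \<open>G\<^sub>n\<close>, where \<open>G\<^sub>n\<close> is a copy of the
Sierpinski graph of some level and sits inside \<open>G\<^bsub>n+1\<^esub>\<close> as the copy with the letter \<open>j\<close> in a ring of \<open>r\<close>
copies. The remaining \<open>r - 1\<close> copies touch \<open>G\<^sub>n\<close> only at the two vertices \<open>A\<^sub>n = (j+f)\<dots>(j+f)\<close> and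
\<open>B\<^sub>n = (j+2f)\<dots>(j+2f)\<close>, so the rest of the graph is seen from \<open>G\<^sub>n\<close> through these two gates only
(lemma \<open>edge_out\<close>). Moreover \<open>A\<^bsub>n+1\<^esub>\<close> is reached from \<open>B\<^sub>n\<close> by a shortest path through \<open>A\<^sub>n\<close>, and
\<open>B\<^bsub>n+1\<^esub>\<close> from \<open>A\<^sub>n\<close> by one through \<open>B\<^sub>n\<close> (lemmas \<open>BA_tower\<close>, \<open>AB_tower\<close>).

From these facts alone the boundary can be read off. A horofunction \<open>h\<close> satisfies
\<open>h(x) = min (d(x,A\<^sub>n) + h(A\<^sub>n)) (d(x,B\<^sub>n) + h(B\<^sub>n))\<close> for \<open>x\<close> in \<open>G\<^sub>n\<close>, so it is determined by the
differences \<open>h(A\<^sub>n) - h(B\<^sub>n)\<close>, which are at most \<open>\<ell>\<^sub>n = d(A\<^sub>n,B\<^sub>n)\<close> in absolute value.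
  \<^item> If the difference is always \<open>-\<ell>\<^sub>n\<close>, then \<open>h\<close> is the limit along the geodesic ray through the
    vertices \<open>A\<^sub>n\<close>; if it is always \<open>\<ell>\<^sub>n\<close>, then \<open>h\<close> is the limit along the vertices \<open>B\<^sub>n\<close>. These are two
    different Busemann points.
  \<^item> Otherwise \<open>\<bar>h(A\<^sub>N) - h(B\<^sub>N)\<bar> < \<ell>\<^sub>N\<close> for some \<open>N\<close> (lemma \<open>gated_trichotomy\<close>). Then \<open>h\<close> is determined
    by \<open>N\<close> and by the integer \<open>h(A\<^sub>N) - h(B\<^sub>N)\<close> (lemma \<open>slack_determined\<close>), so there are only countably
    many such \<open>h\<close>. None of them is a Busemann point: a ray has to leave each \<open>G\<^sub>n\<close> through one of the
    gates, say \<open>A\<^sub>n\<close>, and this forces \<open>h(B\<^sub>N) = \<ell>\<^sub>N + h(A\<^sub>N)\<close> (lemma \<open>slack_not_busemann\<close>).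
  \<^item> There are infinitely many of them. Along a walk from \<open>A\<^sub>n\<close> to \<open>B\<^sub>n\<close> that avoids the rest of \<open>G\<^sub>n\<close>, the
    integer \<open>d(A\<^sub>N,v) - d(B\<^sub>N,v)\<close> goes from \<open>-\<ell>\<^sub>N\<close> to \<open>\<ell>\<^sub>N\<close> in steps of at most 2, so it takes one of
    any two consecutive values; one of the two is taken for infinitely many \<open>n\<close>, and the corresponding
    vertices converge to a horofunction (lemma \<open>ex_slack_horofunction\<close>). Finally \<open>\<ell>\<^sub>N\<close> is unbounded.

Two things remain. The first is the metric geometry of the finite graphs. Upper bounds for distances
come from explicit walks. Lower bounds come from integer functions that change by at most 1 along
every edge; lemma \<open>ring_extension\<close> extends such a function from one copy to the whole ring, given its
values at the vertices shared by neighbouring copies. This determines by induction all distances that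
are needed (lemma \<open>corner_distances\<close>) and shows that copies are isometrically embedded. The second is
that the limit graph, which is given only through isometries of balls, really is such a union. The
pointed isometric embeddings of the \<open>n\<close>-th finite graph into it form a finite nonempty set, and a
compactness argument yields a coherent choice; the images exhaust the limit because balls in it have
the same number of vertices as balls in the finite graphs (lemma \<open>limit_is_union\<close>).
\<close>

section \<open>Distances in graphs\<close>

definition walk_connected :: "'v graph \<Rightarrow> bool" where
  "walk_connected G \<longleftrightarrow> edges G \<subseteq> verts G \<times> verts G \<and> sym (edges G) \<and>
     (\<forall>u\<in>verts G. \<forall>v\<in>verts G. (u, v) \<in> (edges G)\<^sup>*)"

lemma walk_connected_if_connected_graph: "connected_graph G \<Longrightarrow> walk_connected G"
  by (auto simp: connected_graph_def walk_connected_def)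

lemma gdist_le: "(u, v) \<in> edges G ^^ k \<Longrightarrow> gdist G u v \<le> k"
  unfolding gdist_def by (rule Least_le)

lemma gdist_self [simp]: "gdist G u u = 0"
  using gdist_le[where G = G and u = u and v = u and k = 0] by simp

lemma gdist_walk:
  assumes "walk_connected G" "u \<in> verts G" "v \<in> verts G"
  shows "(u, v) \<in> edges G ^^ gdist G u v"
proof -
  have "\<exists>n. (u, v) \<in> edges G ^^ n"
    using assms unfolding walk_connected_def rtrancl_power by blast
  then show ?thesis unfolding gdist_def by (rule LeastI_ex)
qed

lemma relpow_sym: "sym E \<Longrightarrow> (u, v) \<in> E ^^ n \<Longrightarrow> (v, u) \<in> E ^^ n"
proof (induction n arbitrary: v)
  case (Suc n)
  then obtain w where "(u, w) \<in> E ^^ n" "(w, v) \<in> E" by auto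
  then have "(w, u) \<in> E ^^ n" "(v, w) \<in> E" using Suc by (auto dest: symD)
  then show ?case by (metis relpow_Suc_I2)
qed auto

lemma gdist_commute: "walk_connected G \<Longrightarrow> gdist G u v = gdist G v u"
proof -
  assume "walk_connected G"
  then have "sym (edges G)" by (simp add: walk_connected_def)
  then have "(u, v) \<in> edges G ^^ n \<longleftrightarrow> (v, u) \<in> edges G ^^ n" for n
    using relpow_sym by metis
  then show ?thesis by (simp add: gdist_def)
qed

lemma gdist_triangle:
  assumes "walk_connected G" "u \<in> verts G" "v \<in> verts G" "w \<in> verts G"
  shows "gdist G u w \<le> gdist G u v + gdist G v w"
proof (rule gdist_le)
  have "(u, w) \<in> edges G ^^ gdist G u v O edges G ^^ gdist G v w"
    using gdist_walk[OF assms(1-3)] gdist_walk[OF assms(1,3,4)] by blast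
  then show "(u, w) \<in> edges G ^^ (gdist G u v + gdist G v w)"
    by (simp add: relpow_add)
qed

lemma gdist_eq_0:
  assumes "walk_connected G" "u \<in> verts G" "v \<in> verts G"
  shows "gdist G u v = 0 \<longleftrightarrow> u = v"
  using gdist_walk[OF assms] by (cases "gdist G u v = 0") auto

lemma gdist_edge: "(u, v) \<in> edges G \<Longrightarrow> gdist G u v \<le> 1"
  by (rule gdist_le) simp

lemma edge_if_gdist_1:
  assumes "walk_connected G" "u \<in> verts G" "v \<in> verts G" "gdist G u v = 1"
  shows "(u, v) \<in> edges G"
  using gdist_walk[OF assms(1-3)] assms(4) by simp

text \<open>The source of all lower bounds for distances below.\<close>

lemma lipschitz_relpow:
  fixes F :: "'v \<Rightarrow> int"
  assumes "\<And>x y. (x, y) \<in> E \<Longrightarrow> \<bar>F x - F y\<bar> \<le> 1" "(u, v) \<in> E ^^ n"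
  shows "\<bar>F u - F v\<bar> \<le> int n"
  using assms(2)
proof (induction n arbitrary: v)
  case (Suc n)
  then obtain w where w: "(u, w) \<in> E ^^ n" "(w, v) \<in> E" by auto
  from Suc.IH[OF w(1)] assms(1)[OF w(2)] show ?case by simp
qed auto

text \<open>The gate is the last vertex of the walk before its first exit from \<open>H\<close>.\<close>

lemma relpow_through_gate:
  assumes gate: "\<And>x y. (x, y) \<in> E \<Longrightarrow> x \<in> H \<Longrightarrow> y \<notin> H \<Longrightarrow> x = a \<or> x = b"
    and "(x, v) \<in> E ^^ n" "x \<in> H" "v \<notin> H"
  shows "\<exists>g k l. (g = a \<or> g = b) \<and> n = k + l \<and> (x, g) \<in> E ^^ k \<and> (g, v) \<in> E ^^ l"
  using assms(2,3)
proof (induction n arbitrary: x)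
  case 0
  then show ?case using \<open>v \<notin> H\<close> by auto
next
  case (Suc n)
  from Suc.prems(1) obtain y where y: "(x, y) \<in> E" "(y, v) \<in> E ^^ n"
    by (meson relpow_Suc_D2)
  show ?case
  proof (cases "y \<in> H")
    case True
    from Suc.IH[OF y(2) True] obtain g k l where
      "g = a \<or> g = b" "n = k + l" "(y, g) \<in> E ^^ k" "(g, v) \<in> E ^^ l" by (elim exE conjE)
    moreover have "(x, g) \<in> E ^^ Suc k"
      using y(1) \<open>(y, g) \<in> E ^^ k\<close> by (rule relpow_Suc_I2)
    ultimately show ?thesis
      by (intro exI[of _ g] exI[of _ "Suc k"] exI[of _ l]) simp
  next
    case False
    then have "x = a \<or> x = b" using gate y(1) Suc.prems(2) by blast
    then show ?thesis
      using Suc.prems(1) by (intro exI[of _ x] exI[of _ 0] exI[of _ "Suc n"]) auto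
  qed
qed

lemma gdist_through_gate:
  assumes G: "walk_connected G" and H: "H \<subseteq> verts G" "a \<in> H" "b \<in> H" "x \<in> H" "v \<in> verts G - H"
    and gate: "\<And>x y. (x, y) \<in> edges G \<Longrightarrow> x \<in> H \<Longrightarrow> y \<notin> H \<Longrightarrow> x = a \<or> x = b"
  shows "gdist G x v = min (gdist G x a + gdist G a v) (gdist G x b + gdist G b v)"
proof (rule antisym)
  show "gdist G x v \<le> min (gdist G x a + gdist G a v) (gdist G x b + gdist G b v)"
    using H by (auto intro!: gdist_triangle[OF G])
  have "(x, v) \<in> edges G ^^ gdist G x v"
    using H by (auto intro: gdist_walk[OF G])
  then have "\<exists>g k l. (g = a \<or> g = b) \<and> gdist G x v = k + l \<and> (x, g) \<in> edges G ^^ k \<and>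
      (g, v) \<in> edges G ^^ l"
    using H by (intro relpow_through_gate[of "edges G" H] gate) auto
  then obtain g k l where g: "g = a \<or> g = b" and *: "gdist G x v = k + l"
    "(x, g) \<in> edges G ^^ k" "(g, v) \<in> edges G ^^ l" by (elim exE conjE)
  then have "gdist G x g + gdist G g v \<le> gdist G x v"
    using gdist_le[OF *(2)] gdist_le[OF *(3)] by linarith
  then show "min (gdist G x a + gdist G a v) (gdist G x b + gdist G b v) \<le> gdist G x v"
    using g by auto
qed

lemma rtrancl_homomorphic:
  assumes "(x, y) \<in> E\<^sup>*" "\<And>x y. (x, y) \<in> E \<Longrightarrow> (g x, g y) \<in> E'"
  shows "(g x, g y) \<in> E'\<^sup>*"
  using assms(1) by (induction rule: rtrancl_induct) (auto intro: rtrancl_into_rtrancl assms(2))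

text \<open>A discrete intermediate value theorem: as \<open>\<sigma>\<close> changes by at most 2 in one step, it may jump over a
  single integer, but not over two consecutive ones.\<close>

lemma rtrancl_hits_value:
  fixes \<sigma> :: "'a \<Rightarrow> int"
  assumes "(a, b) \<in> R\<^sup>*" and step: "\<And>x y. (x, y) \<in> R \<Longrightarrow> \<bar>\<sigma> x - \<sigma> y\<bar> \<le> 2"
    and "\<sigma> a < s" "s \<le> \<sigma> b"
  shows "\<exists>y\<in>Range R. \<sigma> y = s \<or> \<sigma> y = s + 1"
  using assms(1,4)
proof (induction rule: rtrancl_induct)
  case base
  then show ?case using assms(3) by simp
next
  case (step y z)
  show ?case
  proof (cases "s \<le> \<sigma> y")
    case False
    then have "\<sigma> z = s \<or> \<sigma> z = s + 1" using step assms(2)[OF step(2)] by linarith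
    then show ?thesis using step(2) by blast
  qed (use step in blast)
qed

section \<open>Graphs exhausted through two gates\<close>

text \<open>Every edge leaving \<open>G n\<close> starts in \<open>A n\<close> or \<open>B n\<close>. By \<open>AB\<close> and \<open>BA\<close> the next \<open>B\<close> lies behind the present
  one when seen from \<open>A n\<close>, and vice versa. The last assumption says that the part of the graph
  outside of \<open>G n\<close> connects the two gates; it provides the vertices that converge to non-Busemann
  points.\<close>

locale two_gates =
  fixes X :: "'v graph" and G :: "nat \<Rightarrow> 'v set" and A B :: "nat \<Rightarrow> 'v"
  assumes conn: "walk_connected X"
    and fin: "finite (G n)"
    and mono: "G n \<subseteq> G (Suc n)"
    and cover: "(\<Union>n. G n) = verts X"
    and A_in: "A n \<in> G n" and B_in: "B n \<in> G n"
    and A_new: "A (Suc n) \<notin> G n" and B_new: "B (Suc n) \<notin> G n"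
    and gate: "(x, y) \<in> edges X \<Longrightarrow> x \<in> G n \<Longrightarrow> y \<notin> G n \<Longrightarrow> x = A n \<or> x = B n"
    and AB: "gdist X (A n) (B (Suc n)) = gdist X (A n) (B n) + gdist X (B n) (B (Suc n))"
    and BA: "gdist X (B n) (A (Suc n)) = gdist X (B n) (A n) + gdist X (A n) (A (Suc n))"
    and gap_less: "gdist X (A n) (B n) < gdist X (A (Suc n)) (B (Suc n))"
    and detour: "(A n, B n) \<in> (Restr (edges X) (verts X - G n \<union> {A n, B n}))\<^sup>*"
begin

abbreviation d :: "'v \<Rightarrow> 'v \<Rightarrow> int" where
  "d x y \<equiv> int (gdist X x y)"

lemma G_mono: "m \<le> n \<Longrightarrow> G m \<subseteq> G n"
  using mono by (rule lift_Suc_mono_le)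

lemma G_verts: "x \<in> G n \<Longrightarrow> x \<in> verts X"
  using cover by blast

lemma A_verts [simp]: "A n \<in> verts X" and B_verts [simp]: "B n \<in> verts X"
  using A_in B_in cover by blast+

lemma d_commute: "d x y = d y x"
  by (simp add: gdist_commute[OF conn])

lemma d_triangle: "x \<in> verts X \<Longrightarrow> y \<in> verts X \<Longrightarrow> z \<in> verts X \<Longrightarrow> d x z \<le> d x y + d y z"
  using gdist_triangle[OF conn, of x y z] by linarith

text \<open>All assumptions are symmetric in the two gates, so each statement about \<open>A\<close> below also gives one
  about \<open>B\<close>.\<close>

lemma swap: "two_gates X G B A"
proof unfold_locales
  fix n
  have sym: "sym (edges X)" using conn by (simp add: walk_connected_def)
  have "sym (Restr (edges X) (verts X - G n \<union> {A n, B n}))"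
    using sym by (auto simp: sym_def)
  then have "(B n, A n) \<in> (Restr (edges X) (verts X - G n \<union> {A n, B n}))\<^sup>*"
    using detour by (meson sym_rtrancl symD)
  then show "(B n, A n) \<in> (Restr (edges X) (verts X - G n \<union> {B n, A n}))\<^sup>*"
    by (simp add: insert_commute)
  show "gdist X (B n) (A n) < gdist X (B (Suc n)) (A (Suc n))"
    using gap_less[of n] by (simp add: gdist_commute[OF conn])
  show "x = B n \<or> x = A n" if "(x, y) \<in> edges X" "x \<in> G n" "y \<notin> G n" for x y
    using gate[OF that] by blast
qed (rule conn fin mono cover A_in B_in A_new B_new AB BA)+

lemma through_gate:
  assumes "x \<in> G n" "v \<in> verts X" "v \<notin> G n"
  shows "d x v = min (d x (A n) + d (A n) v) (d x (B n) + d (B n) v)"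
proof -
  have "gdist X x v = min (gdist X x (A n) + gdist X (A n) v) (gdist X x (B n) + gdist X (B n) v)"
    using assms A_in B_in G_verts gate
    by (intro gdist_through_gate[OF conn, of "G n"]) auto
  then show ?thesis by linarith
qed

text \<open>The detour through \<open>B n\<close> on the way to \<open>A (Suc n)\<close> never pays, since by \<open>BA\<close> it has to come back
  through \<open>A n\<close>. Hence all the vertices \<open>A N, A (Suc N), \<dots>\<close> lie on one geodesic starting at \<open>x\<close>.\<close>

lemma far_A:
  assumes "N \<le> n" "x \<in> G N"
  shows "d x (A n) = d x (A N) + d (A N) (A n)"
proof -
  have "\<forall>y\<in>G N. d y (A n) = d y (A N) + d (A N) (A n)"
    using assms(1)
  proof (induction n rule: dec_induct)
    case (step n)
    have "d y (A (Suc n)) = d y (A n) + d (A n) (A (Suc n))" if "y \<in> G N" for y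
    proof -
      have "y \<in> G n" using that G_mono step(1) by auto
      then have "d y (A (Suc n)) =
          min (d y (A n) + d (A n) (A (Suc n))) (d y (B n) + d (B n) (A (Suc n)))"
        using A_new by (intro through_gate) auto
      moreover have "d (B n) (A (Suc n)) = d (B n) (A n) + d (A n) (A (Suc n))"
        using BA[of n] by simp
      moreover have "d y (A n) \<le> d y (B n) + d (B n) (A n)"
        using \<open>y \<in> G n\<close> G_verts by (intro d_triangle) auto
      ultimately show ?thesis by linarith
    qed
    note next_A = this
    show ?case
    proof
      fix y assume "y \<in> G N"
      with next_A[OF this] next_A[OF A_in] bspec[OF step.IH this]
      show "d y (A (Suc n)) = d y (A N) + d (A N) (A (Suc n))" by linarith
    qed
  qed auto
  with assms(2) show ?thesis by blast
qed

lemma far_B: "N \<le> n \<Longrightarrow> x \<in> G N \<Longrightarrow> d x (B n) = d x (B N) + d (B N) (B n)"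
  by (rule two_gates.far_A[OF swap])

lemma A_far_away: "N \<le> n \<Longrightarrow> int n - int N \<le> d (A N) (A n)"
proof (induction n rule: dec_induct)
  case (step n)
  have "A n \<noteq> A (Suc n)" using A_in A_new by metis
  then have "d (A n) (A (Suc n)) \<ge> 1"
    using gdist_eq_0[OF conn, of "A n" "A (Suc n)"] by simp
  moreover have "d (A N) (A (Suc n)) = d (A N) (A n) + d (A n) (A (Suc n))"
    using far_A[of n "Suc n" "A N"] A_in G_mono[OF step(1)] by auto
  ultimately show ?case using step.IH by linarith
qed simp

lemma B_far_away: "N \<le> n \<Longrightarrow> int n - int N \<le> d (B N) (B n)"
  by (rule two_gates.A_far_away[OF swap])

lemma gap_ge: "int n \<le> d (A n) (B n)"
proof (induction n)
  case (Suc n)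
  then show ?case using gap_less[of n] by linarith
qed simp

text \<open>The functions that look on \<open>G n\<close> like a distance from something outside: normalised distance
  functions of far vertices and, as their limits, horofunctions.\<close>

definition gated :: "nat \<Rightarrow> ('v \<Rightarrow> int) \<Rightarrow> bool" where
  "gated n g \<longleftrightarrow> (\<forall>x\<in>G n. g x = min (d x (A n) + g (A n)) (d x (B n) + g (B n)))"

lemma gatedD: "gated n g \<Longrightarrow> x \<in> G n \<Longrightarrow> g x = min (d x (A n) + g (A n)) (d x (B n) + g (B n))"
  by (simp add: gated_def)

lemma gated_swap: "two_gates.gated X G B A n g \<longleftrightarrow> gated n g"
  unfolding gated_def two_gates.gated_def[OF swap] by (simp add: min.commute)

lemma gated_cong:
  assumes "\<And>x. x \<in> G n \<Longrightarrow> g x = g' x"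
  shows "gated n g \<longleftrightarrow> gated n g'"
  using assms A_in B_in by (simp add: gated_def)

lemma gated_gap:
  assumes "gated n g"
  shows "\<bar>g (A n) - g (B n)\<bar> \<le> d (A n) (B n)"
  using gatedD[OF assms A_in] gatedD[OF assms B_in] d_commute[of "A n" "B n"]
  by (simp add: min_def split: if_splits)

text \<open>If the difference of the values at the two gates of \<open>G N\<close> is not extremal, then the minimum at \<open>A N\<close>
  is not attained through \<open>B n\<close>: by \<open>far_B\<close> the path to \<open>B n\<close> runs through \<open>B N\<close>, which would make
  \<open>g (A N)\<close> exceed \<open>g (B N)\<close> by the full distance.\<close>

lemma slack_A:
  assumes "gated n g" "N \<le> n" "\<bar>g (A N) - g (B N)\<bar> < d (A N) (B N)"
  shows "g (A N) = d (A N) (A n) + g (A n)"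
proof -
  have in_n: "A N \<in> G n" "B N \<in> G n" using A_in B_in G_mono[OF assms(2)] by auto
  have "d (A N) (B n) = d (A N) (B N) + d (B N) (B n)"
    using far_B[OF assms(2) A_in] .
  with gatedD[OF assms(1) in_n(1)] gatedD[OF assms(1) in_n(2)] assms(3) show ?thesis
    by linarith
qed

lemma slack_B:
  assumes "gated n g" "N \<le> n" "\<bar>g (A N) - g (B N)\<bar> < d (A N) (B N)"
  shows "g (B N) = d (B N) (B n) + g (B n)"
  using two_gates.slack_A[OF swap, of n g N] assms d_commute[of "A N" "B N"]
  by (simp add: gated_swap abs_minus_commute)

lemma slack_formula:
  assumes "gated n g" "N \<le> n" "\<bar>g (A N) - g (B N)\<bar> < d (A N) (B N)" "x \<in> G n"
  shows "g x = min (d x (A n) - d (A N) (A n) + g (A N)) (d x (B n) - d (B N) (B n) + g (B N))"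
  using gatedD[OF assms(1,4)] slack_A[OF assms(1-3)] slack_B[OF assms(1-3)] by simp

text \<open>The opposite, extremal case: everything is seen through \<open>A n\<close>.\<close>

lemma tight_A:
  assumes "gated n g" "g (B n) = g (A n) + d (A n) (B n)" "x \<in> G n"
  shows "g x = d x (A n) + g (A n)"
proof -
  have "d x (A n) \<le> d x (B n) + d (B n) (A n)"
    using assms(3) G_verts by (intro d_triangle) auto
  then show ?thesis using gatedD[OF assms(1,3)] assms(2) d_commute[of "A n" "B n"] by linarith
qed

lemma tight_A_below:
  assumes "gated n g" "g (B n) = g (A n) + d (A n) (B n)" "N \<le> n"
  shows "g (B N) = g (A N) + d (A N) (B N)"
proof -
  have "A N \<in> G n" "B N \<in> G n" using A_in B_in G_mono[OF assms(3)] by auto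
  then show ?thesis
    using tight_A[OF assms(1,2)] far_A[OF assms(3) B_in] d_commute[of "A N" "B N"] by simp
qed

lemma tight_B_below:
  assumes "gated n g" "g (A n) = g (B n) + d (A n) (B n)" "N \<le> n"
  shows "g (A N) = g (B N) + d (A N) (B N)"
  using two_gates.tight_A_below[OF swap, of n g N] assms d_commute
  by (simp add: gated_swap)

text \<open>Extremality of the difference, with a given sign, is inherited by all smaller indices
  (\<open>tight_A_below\<close>, \<open>tight_B_below\<close>). If it fails for both signs, it therefore fails at a common index.\<close>

lemma gated_trichotomy:
  assumes "\<And>n. gated n g"
  obtains "\<And>n. g (B n) = g (A n) + d (A n) (B n)"
    | "\<And>n. g (A n) = g (B n) + d (A n) (B n)"
    | N where "\<bar>g (A N) - g (B N)\<bar> < d (A N) (B N)"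
proof (cases "(\<forall>n. g (B n) = g (A n) + d (A n) (B n)) \<or> (\<forall>n. g (A n) = g (B n) + d (A n) (B n))")
  case False
  then obtain k l where "g (B k) \<noteq> g (A k) + d (A k) (B k)" "g (A l) \<noteq> g (B l) + d (A l) (B l)"
    by blast
  then have "g (B (max k l)) \<noteq> g (A (max k l)) + d (A (max k l)) (B (max k l))"
    "g (A (max k l)) \<noteq> g (B (max k l)) + d (A (max k l)) (B (max k l))"
    using tight_A_below[OF assms _ max.cobounded1] tight_B_below[OF assms _ max.cobounded2]
    by blast+
  then have "\<bar>g (A (max k l)) - g (B (max k l))\<bar> < d (A (max k l)) (B (max k l))"
    using gated_gap[OF assms, of "max k l"] by linarith
  then show ?thesis using that by blast
qed (use that in blast)

end

section \<open>The horofunction boundary of a graph exhausted through two gates\<close>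

text \<open>As the factors are discrete, the basic open sets prescribe finitely many values.\<close>

lemma in_closure_discrete_product_iff:
  fixes S :: "('a \<Rightarrow> 'b) set"
  assumes "S \<subseteq> extensional I"
  shows "h \<in> product_topology (\<lambda>_. discrete_topology UNIV) I closure_of S \<longleftrightarrow>
    h \<in> extensional I \<and> (\<forall>F. finite F \<longrightarrow> F \<subseteq> I \<longrightarrow> (\<exists>g\<in>S. \<forall>x\<in>F. g x = h x))"
    (is "h \<in> ?T closure_of S \<longleftrightarrow> _ \<and> ?approx")
proof (intro iffI conjI)
  assume h: "h \<in> ?T closure_of S"
  then show "h \<in> extensional I"
    using closure_of_subset_topspace[of ?T S] by (auto simp: PiE_def)
  then have h_self: "h \<in> (\<Pi>\<^sub>E x\<in>I. if x \<in> F then {h x} else UNIV)" for F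
    by (auto simp: PiE_def)
  show ?approx
  proof (intro allI impI)
    fix F assume F: "finite F" "F \<subseteq> I"
    have "openin ?T (\<Pi>\<^sub>E x\<in>I. if x \<in> F then {h x} else UNIV)"
      using F by (intro product_topology_basis) (auto elim: rev_finite_subset[of F] split: if_splits)
    with h h_self obtain g where "g \<in> S" "g \<in> (\<Pi>\<^sub>E x\<in>I. if x \<in> F then {h x} else UNIV)"
      unfolding in_closure_of by blast
    then show "\<exists>g\<in>S. \<forall>x\<in>F. g x = h x"
      using F(2) by (intro bexI[of _ g]) (auto dest!: PiE_mem split: if_splits)
  qed
next
  assume "h \<in> extensional I \<and> ?approx"
  then have ext: "h \<in> extensional I" and ?approx by blast+
  show "h \<in> ?T closure_of S"
    unfolding in_closure_of
  proof (intro conjI allI impI)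
    show "h \<in> topspace ?T" using ext by (auto simp: PiE_def)
    fix U assume "h \<in> U \<and> openin ?T U"
    then obtain W where W: "finite {x \<in> I. W x \<noteq> UNIV}" "h \<in> (\<Pi>\<^sub>E x\<in>I. W x)" "(\<Pi>\<^sub>E x\<in>I. W x) \<subseteq> U"
      unfolding openin_product_topology_alt by auto
    with \<open>?approx\<close> obtain g where g: "g \<in> S" "\<forall>x\<in>{x \<in> I. W x \<noteq> UNIV}. g x = h x"
      by (metis (no_types, lifting) mem_Collect_eq subsetI)
    have "g \<in> (\<Pi>\<^sub>E x\<in>I. W x)"
    proof (intro PiE_I)
      fix x assume "x \<in> I"
      then show "g x \<in> W x" using g(2) PiE_mem[OF W(2)] by (cases "W x = UNIV") auto
    next
      fix x assume "x \<notin> I"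
      then show "g x = undefined" using g(1) assms by (auto simp: extensional_def)
    qed
    then show "\<exists>y. y \<in> S \<and> y \<in> U" using g(1) W(3) by blast
  qed
qed

locale two_gates_based = two_gates +
  fixes x0 :: 'a
  assumes x0: "x0 \<in> verts X"
begin

lemma swap_based: "two_gates_based X G B A x0"
  using swap x0 by (simp add: two_gates_based_def two_gates_based_axioms_def)

lemma dbar_apply: "x \<in> verts X \<Longrightarrow> dbar X x0 v x = d x v - d x0 v"
  by (simp add: dbar_def)

lemma gated_dbar:
  assumes "v \<in> verts X" "v \<notin> G n"
  shows "gated n (dbar X x0 v)"
  unfolding gated_def
proof
  fix x assume "x \<in> G n"
  then show "dbar X x0 v x = min (d x (A n) + dbar X x0 v (A n)) (d x (B n) + dbar X x0 v (B n))"
    using through_gate[OF _ assms, of x] by (simp add: dbar_apply G_verts)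
qed

lemma finite_subset_G:
  assumes "finite F" "F \<subseteq> verts X"
  obtains n where "F \<subseteq> G n" "x0 \<in> G n"
proof -
  have "\<forall>x\<in>insert x0 F. \<exists>n. x \<in> G n" using assms(2) x0 cover by auto
  then obtain k where k: "\<And>x. x \<in> insert x0 F \<Longrightarrow> x \<in> G (k x)" by metis
  have "x \<in> G (Max (k ` insert x0 F))" if "x \<in> insert x0 F" for x
    using k[OF that] G_mono[of "k x" "Max (k ` insert x0 F)"] that assms(1) by auto
  then show ?thesis by (intro that) auto
qed

text \<open>The value at \<open>x0\<close> shows that \<open>h (A n) = - d x0 (A n)\<close> or \<open>h (B n) = - d x0 (B n)\<close>, for every large \<open>n\<close>,
  so \<open>h\<close> is unbounded below, whereas normalised distance functions are bounded below.\<close>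

lemma gated_not_dbar:
  assumes "\<And>n. gated n h" "h x0 = 0" "v \<in> verts X"
  shows "h \<noteq> dbar X x0 v"
proof
  assume h: "h = dbar X x0 v"
  obtain N where N: "x0 \<in> G N" using finite_subset_G[of "{}"] by auto
  define n where "n = N + gdist X x0 v + 1"
  have "N \<le> n" by (simp add: n_def)
  then have "x0 \<in> G n" using N G_mono by blast
  with gatedD[OF assms(1)] assms(2) have "d x0 (A n) + h (A n) = 0 \<or> d x0 (B n) + h (B n) = 0"
    by (metis min_def)
  moreover have "- d x0 v \<le> h y" if "y \<in> verts X" for y
    using that by (simp add: h dbar_apply)
  ultimately have "d x0 (A n) \<le> d x0 v \<or> d x0 (B n) \<le> d x0 v"
    by (smt (verit) A_verts B_verts)
  moreover have "d x0 (A n) \<ge> int n - int N" "d x0 (B n) \<ge> int n - int N"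
    using far_A[OF \<open>N \<le> n\<close> N] far_B[OF \<open>N \<le> n\<close> N] A_far_away[OF \<open>N \<le> n\<close>] B_far_away[OF \<open>N \<le> n\<close>]
    by linarith+
  ultimately show False by (simp add: n_def)
qed

text \<open>Horofunctions are the limits of vertices that leave every \<open>G n\<close>. A limit point of the image that is
  not in the image is, on any finite set, approximated by distance functions; enlarging \<open>G n\<close> by
  witnesses that \<open>h\<close> differs from the distance function of each of its vertices makes sure that the
  approximating vertex is not in \<open>G n\<close>.\<close>

lemma horoboundary_iff:
  "h \<in> horoboundary X x0 \<longleftrightarrow> h \<in> extensional (verts X) \<and>
     (\<forall>n. \<exists>v\<in>verts X - G n. \<forall>x\<in>G n. h x = dbar X x0 v x)"
    (is "_ \<longleftrightarrow> ?ext \<and> ?far")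
proof -
  have ext: "dbar X x0 ` verts X \<subseteq> extensional (verts X)" by (auto simp: dbar_def)
  have "?far" if h: "h \<in> horoboundary X x0"
  proof
    fix n
    have "\<forall>v\<in>G n. \<exists>x\<in>verts X. h x \<noteq> dbar X x0 v x"
    proof
      fix v assume "v \<in> G n"
      then have "h \<noteq> dbar X x0 v" using h G_verts unfolding horoboundary_def by blast
      moreover have "h \<in> extensional (verts X)"
        using h unfolding horoboundary_def Diff_iff in_closure_discrete_product_iff[OF ext] by blast
      ultimately show "\<exists>x\<in>verts X. h x \<noteq> dbar X x0 v x"
        by (metis dbar_def extensionalityI restrict_extensional)
    qed
    then obtain w where w: "\<And>v. v \<in> G n \<Longrightarrow> w v \<in> verts X \<and> h (w v) \<noteq> dbar X x0 v (w v)" by metis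
    have "finite (G n \<union> w ` G n)" "G n \<union> w ` G n \<subseteq> verts X" using fin w G_verts by auto
    with h obtain v where v: "v \<in> verts X" "\<forall>x\<in>G n \<union> w ` G n. dbar X x0 v x = h x"
      unfolding horoboundary_def Diff_iff in_closure_discrete_product_iff[OF ext] by blast
    then have "v \<notin> G n" using w by fastforce
    with v show "\<exists>v\<in>verts X - G n. \<forall>x\<in>G n. h x = dbar X x0 v x"
      by (intro bexI[of _ v]) auto
  qed
  moreover have "h \<in> horoboundary X x0" if ?ext ?far
  proof -
    have "gated n h" for n
      using \<open>?far\<close> gated_dbar gated_cong by (metis (no_types, lifting) DiffE)
    moreover have "h x0 = 0"
    proof -
      obtain N where "x0 \<in> G N" using finite_subset_G[of "{}"] by auto
      then show ?thesis using \<open>?far\<close> x0 by (metis dbar_apply diff_self)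
    qed
    ultimately have "h \<notin> dbar X x0 ` verts X" using gated_not_dbar by blast
    moreover have "\<exists>g\<in>dbar X x0 ` verts X. \<forall>x\<in>F. g x = h x" if F: "finite F" "F \<subseteq> verts X" for F
    proof -
      obtain n where "F \<subseteq> G n" using F finite_subset_G by blast
      with \<open>?far\<close> obtain v where "v \<in> verts X" "\<forall>x\<in>F. h x = dbar X x0 v x" by blast
      then show ?thesis by auto
    qed
    ultimately show ?thesis
      unfolding horoboundary_def Diff_iff in_closure_discrete_product_iff[OF ext] using \<open>?ext\<close> by blast
  qed
  moreover have "h \<in> extensional (verts X)" if "h \<in> horoboundary X x0"
    using that unfolding horoboundary_def Diff_iff in_closure_discrete_product_iff[OF ext] by blast
  ultimately show ?thesis by blast
qed

lemma boundary_approx: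
  "h \<in> horoboundary X x0 \<Longrightarrow> \<exists>v\<in>verts X - G n. \<forall>x\<in>G n. h x = dbar X x0 v x"
  using horoboundary_iff[of h] by blast

lemma boundary_gated: "h \<in> horoboundary X x0 \<Longrightarrow> gated n h"
  by (drule boundary_approx[of h n]) (use gated_dbar gated_cong in blast)

lemma boundary_base:
  assumes "h \<in> horoboundary X x0"
  shows "h x0 = 0"
proof -
  obtain N where "x0 \<in> G N" using finite_subset_G[of "{}"] by auto
  then obtain v where "h x0 = dbar X x0 v x0" using boundary_approx[OF assms, of N] by blast
  then show ?thesis using x0 by (simp add: dbar_apply)
qed

lemma boundary_ext:
  assumes "h \<in> horoboundary X x0" "h' \<in> horoboundary X x0"
    "\<And>x. x \<in> verts X \<Longrightarrow> h x = h' x"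
  shows "h = h'"
proof (rule extensionalityI[of h "verts X" h'])
  show "h \<in> extensional (verts X)"
    by (rule conjunct1[OF iffD1[OF horoboundary_iff assms(1)]])
  show "h' \<in> extensional (verts X)"
    by (rule conjunct1[OF iffD1[OF horoboundary_iff assms(2)]])
  show "h x = h' x" if "x \<in> verts X" for x
    by (rule assms(3)[OF that])
qed

text \<open>Coherent sequences of vertices converge, and the limit agrees with the \<open>n\<close>-th distance function on
  the whole of \<open>G n\<close>.\<close>

lemma boundary_limit:
  assumes M: "infinite M" and v: "\<And>n. n \<in> M \<Longrightarrow> v n \<in> verts X - G n"
    and coherent: "\<And>m n x. m \<in> M \<Longrightarrow> n \<in> M \<Longrightarrow> m \<le> n \<Longrightarrow> x \<in> G m \<Longrightarrow>
      dbar X x0 (v n) x = dbar X x0 (v m) x"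
  obtains h where "h \<in> horoboundary X x0" "\<And>n x. n \<in> M \<Longrightarrow> x \<in> G n \<Longrightarrow> h x = dbar X x0 (v n) x"
proof -
  define k where "k x = (LEAST n. n \<in> M \<and> x \<in> G n)" for x
  define h where "h = (\<lambda>x\<in>verts X. dbar X x0 (v (k x)) x)"
  have h: "h x = dbar X x0 (v n) x" if "n \<in> M" "x \<in> G n" for n x
  proof -
    have "k x \<in> M \<and> x \<in> G (k x)"
      unfolding k_def by (rule LeastI[of "\<lambda>n. n \<in> M \<and> x \<in> G n"]) (use that in blast)
    moreover have "k x \<le> n"
      unfolding k_def by (rule Least_le) (use that in blast)
    ultimately show ?thesis
      using coherent[of "k x" n x] that G_verts[OF that(2)] by (simp add: h_def)
  qed
  have "\<exists>w\<in>verts X - G n. \<forall>x\<in>G n. h x = dbar X x0 w x" for n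
  proof -
    obtain m where "m \<in> M" "n \<le> m" using M unfolding infinite_nat_iff_unbounded_le by blast
    then have "v m \<in> verts X - G n" "G n \<subseteq> G m" using v[of m] G_mono[of n m] by auto
    then show ?thesis using h[OF \<open>m \<in> M\<close>] by (intro bexI[of _ "v m"] ballI) auto
  qed
  moreover have "h \<in> extensional (verts X)" by (simp add: h_def)
  ultimately have "h \<in> horoboundary X x0" using horoboundary_iff[of h] by blast
  then show ?thesis using h by (rule that)
qed

definition tight :: "('a \<Rightarrow> int) \<Rightarrow> bool" where
  "tight h \<longleftrightarrow> (\<forall>n. h (B n) = h (A n) + d (A n) (B n))"

lemma tight_formula:
  assumes "h \<in> horoboundary X x0" "tight h" "x0 \<in> G n" "x \<in> G n"
  shows "h x = d x (A n) - d x0 (A n)"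
proof -
  have "h (B n) = h (A n) + d (A n) (B n)" using assms(2) by (simp add: tight_def)
  from tight_A[OF boundary_gated[OF assms(1)] this] assms(3,4) boundary_base[OF assms(1)]
  show ?thesis by fastforce
qed

text \<open>The sequence \<open>A (Suc n)\<close> rather than \<open>A n\<close> is used because it lies outside of \<open>G n\<close>.\<close>

lemma ex1_tight: "\<exists>!h. h \<in> horoboundary X x0 \<and> tight h"
proof (rule ex_ex1I)
  obtain N where N: "x0 \<in> G N" using finite_subset_G[of "{}"] by auto
  have base: "x0 \<in> G n" if "n \<ge> N" for n using N G_mono that by blast
  obtain h where h: "h \<in> horoboundary X x0"
    "\<And>n x. n \<in> {N..} \<Longrightarrow> x \<in> G n \<Longrightarrow> h x = dbar X x0 (A (Suc n)) x"
  proof (rule boundary_limit[of "{N..}" "\<lambda>n. A (Suc n)"])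
    fix m n x assume "m \<in> {N..}" "n \<in> {N..}" "m \<le> n" "x \<in> G m"
    then have "x \<in> G (Suc m)" "x0 \<in> G (Suc m)" "Suc m \<le> Suc n"
      using mono base by auto
    then show "dbar X x0 (A (Suc n)) x = dbar X x0 (A (Suc m)) x"
      using far_A[of "Suc m" "Suc n" x] far_A[of "Suc m" "Suc n" x0]
      by (simp add: dbar_apply G_verts)
  qed (auto simp: A_new infinite_Ici)
  have "h (B n) = h (A n) + d (A n) (B n)" for n
  proof -
    let ?m = "max N n"
    have "h (B ?m) = h (A ?m) + d (A ?m) (B ?m)"
      using h(2)[of ?m] A_in[of ?m] B_in[of ?m] BA[of ?m] d_commute[of "A ?m" "B ?m"]
      by (simp add: dbar_apply)
    then show ?thesis using tight_A_below[OF boundary_gated[OF h(1)], of ?m n] by simp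
  qed
  then show "\<exists>h. h \<in> horoboundary X x0 \<and> tight h" using h(1) by (auto simp: tight_def)
next
  fix h h' assume h: "h \<in> horoboundary X x0 \<and> tight h" "h' \<in> horoboundary X x0 \<and> tight h'"
  show "h = h'"
  proof (rule boundary_ext)
    fix x assume "x \<in> verts X"
    then obtain n where "x \<in> G n" "x0 \<in> G n" using finite_subset_G[of "{x}"] by auto
    then show "h x = h' x" using h tight_formula by metis
  qed (use h in auto)
qed

text \<open>The ray visits the vertices \<open>A n\<close> at the times \<open>d (A 0) (A n)\<close>; it is exactly geodesic by \<open>far_A\<close>.\<close>

lemma tight_busemann:
  assumes h: "h \<in> horoboundary X x0" "tight h"
  shows "h \<in> busemann_points X x0"
proof -
  define \<tau> where "\<tau> n = gdist X (A 0) (A n)" for n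
  have add: "gdist X (A m) (A n) + \<tau> m = \<tau> n" if "m \<le> n" for m n
    using far_A[OF that, of "A 0"] A_in[of 0] G_mono[of 0 m] by (auto simp: \<tau>_def)
  have \<tau>: "strict_mono \<tau>"
  proof (rule strict_monoI_Suc)
    fix n show "\<tau> n < \<tau> (Suc n)" using add[of n "Suc n"] A_far_away[of n "Suc n"] by simp
  qed
  define \<gamma> where "\<gamma> t = A (inv \<tau> t)" for t
  have \<gamma>: "\<gamma> (\<tau> n) = A n" for n
    using \<tau> by (simp add: \<gamma>_def strict_mono_imp_inj_on)
  have \<tau>0: "\<tau> 0 = 0" by (simp add: \<tau>_def)
  have \<gamma>0: "\<gamma> 0 = A 0" using \<gamma>[of 0] \<tau>0 by simp
  have ray: "almost_geodesic_ray X (range \<tau>) \<gamma>"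
    unfolding almost_geodesic_ray_def
  proof (intro conjI exI[of _ 0] ballI impI)
    show "\<not> bdd_above (range \<tau>)"
    proof
      assume "bdd_above (range \<tau>)"
      then have "finite (range \<tau>)" by (simp add: bdd_above_nat)
      then show False using \<tau> finite_imageD strict_mono_imp_inj_on by blast
    qed
    show "0 \<in> range \<tau>" using \<tau>0 by (metis rangeI)
    show "\<gamma> ` range \<tau> \<subseteq> verts X" by (auto simp: \<gamma>_def)
    show "gdist X (\<gamma> t) (\<gamma> 0) = t" if "t \<in> range \<tau>" for t
      using that \<gamma> \<gamma>0 gdist_commute[OF conn] by (auto simp: \<tau>_def)
    fix t s assume "t \<in> range \<tau>" "s \<in> range \<tau>" "s \<le> t \<and> 0 \<le> int s"
    then obtain m n where mn: "s = \<tau> m" "t = \<tau> n" "m \<le> n"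
      using \<tau> by (auto simp: strict_mono_less_eq)
    have "gdist X (A n) (A m) + gdist X (A m) (A 0) = \<tau> n"
      using add[OF mn(3)] gdist_commute[OF conn] by (simp add: \<tau>_def)
    then show "\<bar>int (gdist X (\<gamma> t) (\<gamma> s)) + int (gdist X (\<gamma> s) (\<gamma> 0)) - int t\<bar> = 0"
      unfolding mn \<gamma> \<gamma>0 by simp
  qed
  have "((\<lambda>t. dbar X x0 (\<gamma> t) x) \<longlongrightarrow> h x) (inf at_top (principal (range \<tau>)))" if "x \<in> verts X" for x
  proof -
    obtain N where N: "x \<in> G N" "x0 \<in> G N" using finite_subset_G[of "{x}"] \<open>x \<in> verts X\<close> by auto
    have "dbar X x0 (\<gamma> t) x = h x" if t: "t \<in> range \<tau>" "t \<ge> \<tau> N" for t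
    proof -
      obtain n where n: "t = \<tau> n" using t by blast
      then have "N \<le> n" using \<tau> t(2) by (simp add: strict_mono_less_eq)
      have "dbar X x0 (\<gamma> t) x = d x (A n) - d x0 (A n)"
        by (simp add: n \<gamma> dbar_apply \<open>x \<in> verts X\<close>)
      then show ?thesis
        using far_A[OF \<open>N \<le> n\<close> N(1)] far_A[OF \<open>N \<le> n\<close> N(2)] tight_formula[OF h N(2,1)]
        by linarith
    qed
    then show ?thesis
      unfolding tendsto_discrete eventually_inf_principal eventually_at_top_linorder by blast
  qed
  with ray h(1) show ?thesis unfolding busemann_points_def by blast
qed

text \<open>For integer-valued functions, convergence at the finitely many points of \<open>F\<close> means that the values
  are reached. A late vertex \<open>y = \<gamma> s\<close> of the ray can thus replace its end; as the ray is geodesic from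
  some time on, \<open>h y = - d x0 y\<close>.\<close>

lemma busemann_eventually:
  assumes "h \<in> busemann_points X x0" "finite F" "F \<subseteq> verts X"
  shows "\<exists>y\<in>verts X. \<forall>x\<in>F. h x = d x y + h y"
proof -
  obtain T \<gamma> where ray: "almost_geodesic_ray X T \<gamma>"
    and lim: "\<And>x. x \<in> verts X \<Longrightarrow>
      ((\<lambda>t. dbar X x0 (\<gamma> t) x) \<longlongrightarrow> h x) (inf at_top (principal T))"
    using assms(1) unfolding busemann_points_def by blast
  have T: "\<not> bdd_above T" "\<gamma> ` T \<subseteq> verts X" and T0: "\<And>t. t \<in> T \<Longrightarrow> gdist X (\<gamma> t) (\<gamma> 0) = t"
    using ray by (simp_all add: almost_geodesic_ray_def)
  have "\<exists>N::int. \<forall>t\<in>T. \<forall>s\<in>T. t \<ge> s \<and> int s \<ge> N \<longrightarrow>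
      \<bar>d (\<gamma> t) (\<gamma> s) + d (\<gamma> s) (\<gamma> 0) - int t\<bar> = 0"
    using ray unfolding almost_geodesic_ray_def by (elim conjE)
  then obtain N where N: "\<forall>t\<in>T. \<forall>s\<in>T. t \<ge> s \<and> int s \<ge> N \<longrightarrow>
      \<bar>d (\<gamma> t) (\<gamma> s) + d (\<gamma> s) (\<gamma> 0) - int t\<bar> = 0" ..
  have large: "\<exists>t\<in>T. K \<le> t" for K
    using T(1) unfolding bdd_above_def by (meson nle_le)
  have ev: "\<exists>K. \<forall>t\<ge>K. t \<in> T \<longrightarrow> dbar X x0 (\<gamma> t) x = h x" if "x \<in> verts X" for x
    using lim[OF that] unfolding tendsto_discrete eventually_inf_principal eventually_at_top_linorder
    by blast
  then obtain K where K: "\<And>x t. x \<in> verts X \<Longrightarrow> K x \<le> t \<Longrightarrow> t \<in> T \<Longrightarrow> dbar X x0 (\<gamma> t) x = h x"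
    by metis
  have split: "d (\<gamma> s) (\<gamma> t) = int t - int s" if "s \<in> T" "t \<in> T" "s \<le> t" "N \<le> int s" for s t
    using N[rule_format, OF that(2,1) conjI[OF that(3,4)]] T0[OF that(1)] d_commute[of "\<gamma> t" "\<gamma> s"] by linarith
  \<comment> \<open>a late point of the ray sees all of \<open>F\<close> the way \<open>h\<close> does\<close>
  obtain s0 where s0: "s0 \<in> T" "nat N \<le> s0" using large by blast
  obtain s where s: "s \<in> T" "Max (insert s0 (K ` insert (\<gamma> s0) F)) \<le> s" using large by blast
  then have Ks: "K (\<gamma> s0) \<le> s" "s0 \<le> s" "\<And>x. x \<in> F \<Longrightarrow> K x \<le> s" using assms(2) by auto
  have in_V: "\<gamma> s0 \<in> verts X" "\<gamma> s \<in> verts X" using T(2) s0 s by auto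
  obtain t where t: "t \<in> T" "max s (max (K (\<gamma> s0)) (K (\<gamma> s))) \<le> t" using large by blast
  have N_le: "N \<le> int s0" "N \<le> int s" using s0(2) Ks(2) by linarith+
  have "h (\<gamma> s) = - d x0 (\<gamma> s)"
    using K[OF in_V(1) Ks(1) s(1)] K[OF in_V(1) _ t(1)] K[OF in_V(2) _ t(1)] t(2) in_V
      split[OF s0(1) s(1) Ks(2) N_le(1)] split[OF s0(1) t(1) _ N_le(1)] split[OF s(1) t(1) _ N_le(2)]
      Ks(2)
    by (simp add: dbar_apply)
  moreover have "h x = d x (\<gamma> s) - d x0 (\<gamma> s)" if "x \<in> F" for x
    using K[OF _ Ks(3)[OF that] s(1)] that assms(3) dbar_apply by auto
  ultimately show ?thesis using in_V(2) by (intro bexI[of _ "\<gamma> s"]) auto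
qed

text \<open>Suppose that \<open>h\<close> drops by the distance from \<open>B N\<close> to \<open>y\<close>, and again from \<open>y\<close> to \<open>A n\<close>. Then its values drop along a shortest path from
  \<open>B N\<close> to \<open>A n\<close> by the length of that path. As \<open>A N\<close> lies on such a path, the difference at the gates of \<open>G N\<close>
  is extremal.\<close>

lemma no_return_through_A:
  assumes h: "h \<in> horoboundary X x0" and slack: "\<bar>h (A N) - h (B N)\<bar> < d (A N) (B N)"
    and y: "y \<in> verts X" "y \<in> G n" "N \<le> n" "h (B N) = d (B N) y + h y"
  shows "h y \<noteq> d y (A n) + h (A n)"
proof
  assume "h y = d y (A n) + h (A n)"
  then have "h (B N) \<ge> d (B N) (A n) + h (A n)"
    using y(4) d_triangle[of "B N" y "A n"] y(1) by simp
  moreover have "h (A N) = d (A N) (A n) + h (A n)"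
    using slack_A[OF boundary_gated[OF h] y(3) slack] .
  ultimately show False
    using far_A[OF y(3) B_in] slack d_commute[of "A N" "B N"] by linarith
qed

lemma slack_not_busemann:
  assumes h: "h \<in> horoboundary X x0" and slack: "\<bar>h (A N) - h (B N)\<bar> < d (A N) (B N)"
  shows "h \<notin> busemann_points X x0"
proof
  assume "h \<in> busemann_points X x0"
  then obtain y where y: "y \<in> verts X" "h (A N) = d (A N) y + h y" "h (B N) = d (B N) y + h y"
    using busemann_eventually[of h "{A N, B N}"] by auto
  obtain k where "y \<in> G k" using y(1) cover by blast
  then have n: "y \<in> G (max k N)" "N \<le> max k N" using G_mono[of k "max k N"] by auto
  have slack': "\<bar>h (B N) - h (A N)\<bar> < d (B N) (A N)"
    using slack d_commute[of "A N" "B N"] by linarith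
  show False
    using gatedD[OF boundary_gated[OF h] n(1)] no_return_through_A[OF h slack y(1) n y(3)]
      two_gates_based.no_return_through_A[OF swap_based h slack' y(1) n y(2)]
    by (metis min_def)
qed

lemma card_busemann_points: "card (busemann_points X x0) = 2"
proof -
  interpret sw: two_gates_based X G B A x0 by (rule swap_based)
  obtain a where a: "a \<in> horoboundary X x0" "tight a" using ex1_tight by blast
  obtain b where b: "b \<in> horoboundary X x0" "sw.tight b" using sw.ex1_tight by blast
  have "h = a \<or> h = b" if "h \<in> busemann_points X x0" for h
  proof -
    have h: "h \<in> horoboundary X x0" using that by (simp add: busemann_points_def)
    show ?thesis
    proof (rule gated_trichotomy[of h])
      assume "\<And>n. h (B n) = h (A n) + d (A n) (B n)"
      then have "tight h" by (simp add: tight_def)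
      then show ?thesis using ex1_tight h a by blast
    next
      assume "\<And>n. h (A n) = h (B n) + d (A n) (B n)"
      then have "sw.tight h" by (simp add: sw.tight_def d_commute)
      then show ?thesis using sw.ex1_tight h b by blast
    next
      fix N assume "\<bar>h (A N) - h (B N)\<bar> < d (A N) (B N)"
      then show ?thesis using slack_not_busemann[OF h] that by blast
    qed (rule boundary_gated[OF h])
  qed
  moreover have "a \<noteq> b"
    using a(2) b(2) gap_ge[of 1] unfolding tight_def sw.tight_def by (smt (verit) d_commute of_nat_1)
  ultimately have "busemann_points X x0 = {a, b}"
    using tight_busemann[OF a] sw.tight_busemann[OF b] by blast
  with \<open>a \<noteq> b\<close> show ?thesis by simp
qed

lemma slack_determined:
  assumes "gated m g" "gated m g'" "N \<le> m" "\<bar>g (A N) - g (B N)\<bar> < d (A N) (B N)"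
    and "g (A N) - g (B N) = g' (A N) - g' (B N)" "x0 \<in> G m" "g x0 = g' x0" "x \<in> G m"
  shows "g x = g' x"
proof -
  have slack': "\<bar>g' (A N) - g' (B N)\<bar> < d (A N) (B N)" using assms(4,5) by simp
  show ?thesis
    using slack_formula[OF assms(1,3,4,8)] slack_formula[OF assms(2,3) slack' assms(8)]
      slack_formula[OF assms(1,3,4,6)] slack_formula[OF assms(2,3) slack' assms(6)] assms(5,7)
    by linarith
qed

lemma non_busemann_iff:
  "h \<in> non_busemann_points X x0 \<longleftrightarrow>
     h \<in> horoboundary X x0 \<and> (\<exists>N. \<bar>h (A N) - h (B N)\<bar> < d (A N) (B N))"
proof (intro iffI conjI)
  interpret sw: two_gates_based X G B A x0 by (rule swap_based)
  assume "h \<in> non_busemann_points X x0"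
  then have h: "h \<in> horoboundary X x0" and nb: "h \<notin> busemann_points X x0"
    by (auto simp: non_busemann_points_def)
  from h show "h \<in> horoboundary X x0" .
  show "\<exists>N. \<bar>h (A N) - h (B N)\<bar> < d (A N) (B N)"
  proof (rule gated_trichotomy[of h])
    assume "\<And>n. h (B n) = h (A n) + d (A n) (B n)"
    then have "tight h" by (simp add: tight_def)
    then show ?thesis using tight_busemann[OF h] nb by blast
  next
    assume "\<And>n. h (A n) = h (B n) + d (A n) (B n)"
    then have "sw.tight h" by (simp add: sw.tight_def d_commute)
    then show ?thesis using sw.tight_busemann[OF h] nb by blast
  qed (use boundary_gated[OF h] in blast)+
next
  assume "h \<in> horoboundary X x0 \<and> (\<exists>N. \<bar>h (A N) - h (B N)\<bar> < d (A N) (B N))"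
  then show "h \<in> non_busemann_points X x0"
    using slack_not_busemann by (auto simp: non_busemann_points_def)
qed

lemma countable_non_busemann_points: "countable (non_busemann_points X x0)"
proof -
  define S where "S N = {h \<in> horoboundary X x0. \<bar>h (A N) - h (B N)\<bar> < d (A N) (B N)}" for N
  have "countable (S N)" for N
  proof (rule countable_image_inj_on)
    show "inj_on (\<lambda>h. h (A N) - h (B N)) (S N)"
    proof (rule inj_onI)
      fix h h' assume h: "h \<in> S N" "h' \<in> S N" "h (A N) - h (B N) = h' (A N) - h' (B N)"
      show "h = h'"
      proof (rule boundary_ext)
        fix x assume "x \<in> verts X"
        then obtain n where n: "x \<in> G n" "x0 \<in> G n" using finite_subset_G[of "{x}"] by auto
        let ?m = "max n N"
        have "x \<in> G ?m" "x0 \<in> G ?m" using n G_mono[of n ?m] by auto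
        moreover have "h x0 = h' x0" using h boundary_base[of h] boundary_base[of h'] by (simp add: S_def)
        ultimately show "h x = h' x"
          using h boundary_gated by (intro slack_determined[of ?m h h' N x]) (auto simp: S_def)
      qed (use h in \<open>auto simp: S_def\<close>)
    qed
  qed auto
  moreover have "non_busemann_points X x0 = (\<Union>N. S N)"
    using non_busemann_iff by (auto simp: S_def)
  ultimately show ?thesis by simp
qed

text \<open>The function \<open>d (A N) v - d (B N) v\<close> is followed along the walk from \<open>A n\<close> to \<open>B n\<close>. The walk meets
  \<open>G n\<close> only in the two gates, where the function takes its extremal values.\<close>

lemma far_vertex_with_slack:
  assumes "N \<le> n" "- d (A N) (B N) < s" "s + 1 < d (A N) (B N)"
  shows "\<exists>v\<in>verts X - G n. d (A N) v - d (B N) v = s \<or> d (A N) v - d (B N) v = s + 1"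
proof -
  define \<sigma> where "\<sigma> v = d (A N) v - d (B N) v" for v
  have ends: "\<sigma> (A n) = - d (A N) (B N)" "\<sigma> (B n) = d (A N) (B N)"
    using far_A[OF assms(1) B_in] far_B[OF assms(1) A_in] d_commute[of "A N" "B N"]
    by (auto simp: \<sigma>_def)
  have "\<bar>\<sigma> x - \<sigma> y\<bar> \<le> 2" if xy: "(x, y) \<in> edges X" for x y
  proof -
    have "x \<in> verts X" "y \<in> verts X" using xy conn by (auto simp: walk_connected_def)
    then show ?thesis
      using d_triangle[of "A N" x y] d_triangle[of "A N" y x] d_triangle[of "B N" x y]
        d_triangle[of "B N" y x] gdist_edge[OF xy] d_commute[of x y]
      by (simp add: \<sigma>_def)
  qed
  then have "\<exists>y\<in>Range (Restr (edges X) (verts X - G n \<union> {A n, B n})). \<sigma> y = s \<or> \<sigma> y = s + 1"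
    using ends assms(2,3) by (intro rtrancl_hits_value[OF detour]) (blast | linarith)+
  then obtain y where "y \<in> verts X - G n \<union> {A n, B n}" "\<sigma> y = s \<or> \<sigma> y = s + 1"
    by blast
  moreover from this(2) have "y \<noteq> A n" "y \<noteq> B n" using ends assms by auto
  ultimately show ?thesis unfolding \<sigma>_def by blast
qed

text \<open>For each \<open>n\<close> there is a vertex outside of \<open>G n\<close> with difference \<open>s\<close> or \<open>s + 1\<close>, and one value \<open>s'\<close> occurs
  infinitely often. The vertices with this value form a coherent sequence by \<open>slack_determined\<close>.\<close>

lemma ex_slack_horofunction:
  assumes s: "- d (A N) (B N) < s" "s + 1 < d (A N) (B N)"
  shows "\<exists>h\<in>horoboundary X x0. h (A N) - h (B N) = s \<or> h (A N) - h (B N) = s + 1"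
proof -
  define \<sigma> where "\<sigma> v = d (A N) v - d (B N) v" for v
  obtain k where k: "x0 \<in> G k" using finite_subset_G[of "{}"] by auto
  have "\<forall>n. \<exists>v. N \<le> n \<longrightarrow> v \<in> verts X - G n \<and> (\<sigma> v = s \<or> \<sigma> v = s + 1)"
    using far_vertex_with_slack[OF _ s] unfolding \<sigma>_def by blast
  then obtain v where v: "\<And>n. N \<le> n \<Longrightarrow> v n \<in> verts X - G n \<and> (\<sigma> (v n) = s \<or> \<sigma> (v n) = s + 1)"
    by metis
  have "infinite {max k N..}" by (rule infinite_Ici)
  moreover have "{max k N..} = {n. max k N \<le> n \<and> \<sigma> (v n) = s} \<union> {n. max k N \<le> n \<and> \<sigma> (v n) = s + 1}"
    using v by fastforce
  ultimately obtain s' where s': "s' = s \<or> s' = s + 1" "infinite {n. max k N \<le> n \<and> \<sigma> (v n) = s'}"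
    by (metis finite_UnI)
  define M where "M = {n. max k N \<le> n \<and> \<sigma> (v n) = s'}"
  have base: "x0 \<in> G n" if "n \<in> M" for n using k G_mono[of k n] that by (auto simp: M_def)
  have \<sigma>: "dbar X x0 (v n) (A N) - dbar X x0 (v n) (B N) = s'" if "n \<in> M" for n
    using that by (simp add: dbar_apply M_def \<sigma>_def)
  have v_M: "v n \<in> verts X - G n" if "n \<in> M" for n using v that by (auto simp: M_def)
  obtain h where h: "h \<in> horoboundary X x0"
    "\<And>n x. n \<in> M \<Longrightarrow> x \<in> G n \<Longrightarrow> h x = dbar X x0 (v n) x"
  proof (rule boundary_limit[of M v])
    show "infinite M" using s' by (simp add: M_def)
    fix m n x assume *: "m \<in> M" "n \<in> M" "m \<le> n" "x \<in> G m"
    have "v n \<notin> G m" using v_M[OF *(2)] G_mono[OF *(3)] by blast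
    then have "gated m (dbar X x0 (v n))" "gated m (dbar X x0 (v m))"
      using gated_dbar v_M[OF *(1)] v_M[OF *(2)] by blast+
    moreover have "N \<le> m" using *(1) by (simp add: M_def)
    moreover have "\<bar>dbar X x0 (v n) (A N) - dbar X x0 (v n) (B N)\<bar> < d (A N) (B N)"
      using \<sigma>[OF *(2)] s s'(1) by linarith
    moreover have "dbar X x0 (v n) x0 = dbar X x0 (v m) x0" by (simp add: dbar_apply x0)
    moreover have "dbar X x0 (v n) (A N) - dbar X x0 (v n) (B N)
        = dbar X x0 (v m) (A N) - dbar X x0 (v m) (B N)"
      using \<sigma>[OF *(1)] \<sigma>[OF *(2)] by linarith
    ultimately show "dbar X x0 (v n) x = dbar X x0 (v m) x"
      using base[OF *(1)] *(4) by (metis slack_determined)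
  qed (rule v_M, assumption, rule that)
  obtain n where n: "n \<in> M" using s'(2) unfolding M_def by (metis finite.emptyI ex_in_conv)
  then have "N \<le> n" by (simp add: M_def)
  then have "A N \<in> G n" "B N \<in> G n" using A_in B_in G_mono by blast+
  then have "h (A N) - h (B N) = s'" using h(2) n \<sigma> by simp
  with h(1) s'(1) show ?thesis by blast
qed

lemma infinite_non_busemann_points: "infinite (non_busemann_points X x0)"
proof
  assume fin: "finite (non_busemann_points X x0)"
  define c where "c = card (non_busemann_points X x0)"
  \<comment> \<open>then \<open>d (A N) (B N)\<close> leaves room for the pairs of values \<open>{2 * i, 2 * i + 1}\<close> with \<open>i \<le> c\<close>\<close>
  define N where "N = 2 * c + 2"
  have N: "2 * int c + 2 \<le> d (A N) (B N)" using gap_ge[of N] by (simp add: N_def)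
  have "\<exists>h\<in>non_busemann_points X x0. (h (A N) - h (B N)) div 2 = int i" if i: "i \<in> {..c}" for i
  proof -
    obtain h where h: "h \<in> horoboundary X x0"
      "h (A N) - h (B N) = 2 * int i \<or> h (A N) - h (B N) = 2 * int i + 1"
      using ex_slack_horofunction[of N "2 * int i"] N i by auto
    then have "\<bar>h (A N) - h (B N)\<bar> < d (A N) (B N)" using N i by auto
    then have "h \<in> non_busemann_points X x0" using h(1) non_busemann_iff by blast
    moreover have "(h (A N) - h (B N)) div 2 = int i" using h(2) by auto
    ultimately show ?thesis by blast
  qed
  then have "int ` {..c} \<subseteq> (\<lambda>h. (h (A N) - h (B N)) div 2) ` non_busemann_points X x0"
    by force
  then have "card (int ` {..c}) \<le> card (non_busemann_points X x0)"
    using fin by (meson card_image_le card_mono finite_imageI le_trans)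
  moreover have "card (int ` {..c}) = Suc c" by (simp add: card_image)
  ultimately show False by (simp add: c_def)
qed

end

section \<open>Limits of towers of finite graphs\<close>

lemma decreasing_finite_Inter_nonempty:
  fixes E :: "nat \<Rightarrow> 'a set"
  assumes "finite (E 0)" "\<And>k. E (Suc k) \<subseteq> E k" "\<And>k. E k \<noteq> {}"
  shows "(\<Inter>k. E k) \<noteq> {}"
proof
  assume empty: "(\<Inter>k. E k) = {}"
  have mono: "E l \<subseteq> E k" if "k \<le> l" for k l
    using that assms(2) by (rule lift_Suc_antimono_le[rotated])
  have "\<forall>x\<in>E 0. \<exists>k. x \<notin> E k" using empty by blast
  then obtain k where k: "\<And>x. x \<in> E 0 \<Longrightarrow> x \<notin> E (k x)" by metis
  obtain x where x: "x \<in> E (Max (k ` E 0))" using assms(3) by blast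
  then have "x \<in> E 0" using mono[of 0] by blast
  then have "k x \<le> Max (k ` E 0)" using assms(1) by simp
  then show False using mono x k[OF \<open>x \<in> E 0\<close>] by blast
qed

text \<open>Koenig's lemma. The sets \<open>D k n\<close> of elements that can be lifted by \<open>k\<close> levels decrease to a nonempty
  set, and between these limit sets the maps are surjective.\<close>

lemma inverse_limit_nonempty:
  fixes T :: "nat \<Rightarrow> 'a set" and \<rho> :: "nat \<Rightarrow> 'a \<Rightarrow> 'a"
  assumes fin: "\<And>n. finite (T n)" and nonempty: "\<And>n. T n \<noteq> {}"
    and \<rho>: "\<And>n x. x \<in> T (Suc n) \<Longrightarrow> \<rho> n x \<in> T n"
  obtains s where "\<And>n. s n \<in> T n" "\<And>n. \<rho> n (s (Suc n)) = s n"
proof -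
  define D where "D k = ((\<lambda>E n. \<rho> n ` E (Suc n)) ^^ k) T" for k
  have D0: "D 0 n = T n" and D_Suc: "D (Suc k) n = \<rho> n ` D k (Suc n)" for k n
    by (simp_all add: D_def)
  have D_ne: "D k n \<noteq> {}" for k n
    by (induction k arbitrary: n) (use nonempty in \<open>auto simp: D0 D_Suc\<close>)
  have D_dec: "D (Suc k) n \<subseteq> D k n" for k n
  proof (induction k arbitrary: n)
    case 0
    then show ?case using \<rho> by (auto simp: D0 D_Suc)
  next
    case (Suc k)
    then show ?case unfolding D_Suc[of "Suc k"] D_Suc[of k n] by (intro image_mono)
  qed
  have D_fin: "finite (D k n)" for k n
    by (induction k arbitrary: n) (use fin in \<open>auto simp: D0 D_Suc\<close>)
  define L where "L n = (\<Inter>k. D k n)" for n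
  have "\<exists>s. \<forall>n. s n \<in> L n \<and> \<rho> n (s (Suc n)) = s n"
  proof (rule dependent_nat_choice)
    show "\<exists>x. x \<in> L 0"
      using decreasing_finite_Inter_nonempty[of "\<lambda>k. D k 0", OF D_fin D_dec D_ne] by (auto simp: L_def)
    fix x n assume x: "x \<in> L n"
    have "(\<Inter>k. {y \<in> D k (Suc n). \<rho> n y = x}) \<noteq> {}"
    proof (rule decreasing_finite_Inter_nonempty)
      show "finite {y \<in> D 0 (Suc n). \<rho> n y = x}" using D_fin by simp
      show "{y \<in> D (Suc k) (Suc n). \<rho> n y = x} \<subseteq> {y \<in> D k (Suc n). \<rho> n y = x}" for k
        using D_dec by blast
      show "{y \<in> D k (Suc n). \<rho> n y = x} \<noteq> {}" for k
      proof -
        have "x \<in> D (Suc k) n" using x unfolding L_def by blast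
        then show ?thesis unfolding D_Suc by blast
      qed
    qed
    then show "\<exists>y. y \<in> L (Suc n) \<and> \<rho> n y = x" by (auto simp: L_def)
  qed
  then obtain s where s: "\<And>n. s n \<in> L n" "\<And>n. \<rho> n (s (Suc n)) = s n" by blast
  have "s n \<in> T n" for n using s(1)[of n] D0[of n] unfolding L_def by blast
  then show ?thesis using s(2) by (rule that)
qed

text \<open>A single map \<open>e\<close> embeds each level into the next one; below it appends the letter \<open>j\<close> to labels.
  The assumption \<open>escape\<close> makes the balls around the base points stabilise.\<close>

locale pointed_tower =
  fixes H :: "nat \<Rightarrow> 'a graph" and e :: "'a \<Rightarrow> 'a" and P :: "nat \<Rightarrow> 'a"
  assumes finite_H: "finite (verts (H n))" and conn_H: "walk_connected (H n)"
    and e_verts: "x \<in> verts (H n) \<Longrightarrow> e x \<in> verts (H (Suc n))"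
    and e_iso: "x \<in> verts (H n) \<Longrightarrow> y \<in> verts (H n) \<Longrightarrow>
      gdist (H (Suc n)) (e x) (e y) = gdist (H n) x y"
    and P_verts: "P n \<in> verts (H n)" and P_Suc: "P (Suc n) = e (P n)"
    and escape: "v \<in> verts (H (Suc n)) \<Longrightarrow> v \<notin> e ` verts (H n) \<Longrightarrow>
      n < gdist (H (Suc n)) (P (Suc n)) v"
begin

lemma inj_on_e: "inj_on e (verts (H n))"
proof (rule inj_onI)
  fix x y assume xy: "x \<in> verts (H n)" "y \<in> verts (H n)" "e x = e y"
  then have "gdist (H n) x y = 0" using e_iso[of x n y] by simp
  then show "x = y" using gdist_eq_0[OF conn_H] xy by blast
qed

lemma ball_Suc:
  assumes "R \<le> n"
  shows "gball (H (Suc n)) (P (Suc n)) (real R) = e ` gball (H n) (P n) (real R)"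
proof (intro equalityI subsetI)
  fix v assume v: "v \<in> gball (H (Suc n)) (P (Suc n)) (real R)"
  then have "v \<in> e ` verts (H n)"
    using escape[of v n] assms by (force simp: gball_def)
  then obtain x where "v = e x" "x \<in> verts (H n)" by blast
  then show "v \<in> e ` gball (H n) (P n) (real R)"
    using v e_iso[OF P_verts] by (auto simp: gball_def P_Suc)
next
  fix v assume "v \<in> e ` gball (H n) (P n) (real R)"
  then show "v \<in> gball (H (Suc n)) (P (Suc n)) (real R)"
    using e_verts e_iso[OF P_verts] by (auto simp: gball_def P_Suc)
qed

lemma card_ball:
  assumes "R \<le> n" "n \<le> m"
  shows "card (gball (H m) (P m) (real R)) = card (gball (H n) (P n) (real R))"
  using assms(2)
proof (induction m rule: dec_induct)
  case (step m)
  have "inj_on e (gball (H m) (P m) (real R))"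
    using inj_on_e by (rule inj_on_subset) (auto simp: gball_def)
  then show ?case using step ball_Suc[of R m] assms(1) by (simp add: card_image)
qed simp

lemma funpow_e:
  "x \<in> verts (H n) \<Longrightarrow> (e ^^ k) x \<in> verts (H (n + k))"
  "x \<in> verts (H n) \<Longrightarrow> y \<in> verts (H n) \<Longrightarrow>
    gdist (H (n + k)) ((e ^^ k) x) ((e ^^ k) y) = gdist (H n) x y"
  "(e ^^ k) (P n) = P (n + k)"
proof -
  show verts: "(e ^^ k) x \<in> verts (H (n + k))" if "x \<in> verts (H n)" for x k
    by (induction k) (use that e_verts in auto)
  show "gdist (H (n + k)) ((e ^^ k) x) ((e ^^ k) y) = gdist (H n) x y"
    if xy: "x \<in> verts (H n)" "y \<in> verts (H n)" for x y
  proof (induction k)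
    case (Suc k)
    then show ?case using e_iso[OF verts[OF xy(1), of k] verts[OF xy(2), of k]] by simp
  qed simp
  show "(e ^^ k) (P n) = P (n + k)"
    by (induction k) (auto simp: P_Suc)
qed

text \<open>The limit is given only by isometries between balls, separately for every radius. A finite graph
  fits into a ball, so it has pointed isometric embeddings into \<open>X\<close>, and only finitely many; these are
  the sets \<open>T n\<close> to which Koenig's lemma is applied. The images of the embeddings cover \<open>X\<close> because they
  contain as many vertices of a given ball in \<open>X\<close> as the ball has.\<close>

lemma limit_is_union:
  fixes X :: "'v graph" and p :: 'v
  assumes X: "walk_connected X" and p: "p \<in> verts X"
    and lim: "\<And>R::nat. 1 \<le> R \<Longrightarrow> \<exists>M. \<forall>m\<ge>M. \<exists>\<phi>.
      bij_betw \<phi> (gball (H m) (P m) (real R)) (gball X p (real R)) \<and>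
      (\<forall>u\<in>gball (H m) (P m) (real R). \<forall>v\<in>gball (H m) (P m) (real R).
         gdist X (\<phi> u) (\<phi> v) = gdist (H m) u v) \<and> \<phi> (P m) = p"
  obtains \<psi> where "\<And>n x. x \<in> verts (H n) \<Longrightarrow> \<psi> n x \<in> verts X"
    and "\<And>n x y. x \<in> verts (H n) \<Longrightarrow> y \<in> verts (H n) \<Longrightarrow> gdist X (\<psi> n x) (\<psi> n y) = gdist (H n) x y"
    and "\<And>n x. x \<in> verts (H n) \<Longrightarrow> \<psi> (Suc n) (e x) = \<psi> n x"
    and "(\<Union>n. \<psi> n ` verts (H n)) = verts X"
proof -
  have ball_fin: "finite (gball (H n) (P n) R)" for n R
    using finite_H by (rule rev_finite_subset) (auto simp: gball_def)
  have X_ball: "finite (gball X p (real R))"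
    "n \<ge> R \<Longrightarrow> card (gball X p (real R)) = card (gball (H n) (P n) (real R))" if R: "1 \<le> R" for R n
  proof -
    obtain M where M: "\<And>m. m \<ge> M \<Longrightarrow> \<exists>\<phi>. bij_betw \<phi> (gball (H m) (P m) (real R)) (gball X p (real R))"
      using lim[OF R] by blast
    then obtain \<phi> where \<phi>: "bij_betw \<phi> (gball (H (max M n)) (P (max M n)) (real R)) (gball X p (real R))"
      using max.cobounded1 by blast
    then show "finite (gball X p (real R))" using ball_fin bij_betw_finite by blast
    show "card (gball X p (real R)) = card (gball (H n) (P n) (real R))" if "n \<ge> R"
      using bij_betw_same_card[OF \<phi>] card_ball[OF that, of "max M n"] by simp
  qed
  define T where "T n = {\<psi> \<in> verts (H n) \<rightarrow>\<^sub>E verts X. \<psi> (P n) = p \<and>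
    (\<forall>x\<in>verts (H n). \<forall>y\<in>verts (H n). gdist X (\<psi> x) (\<psi> y) = gdist (H n) x y)}" for n
  define D where "D n = Suc (Max (gdist (H n) (P n) ` verts (H n)))" for n
  have D: "gdist (H n) (P n) x \<le> D n" if "x \<in> verts (H n)" for n x
    using that finite_H by (simp add: D_def le_SucI)
  have D_pos: "1 \<le> D n" for n by (simp add: D_def)
  have T_fin: "finite (T n)" for n
  proof (rule finite_subset)
    show "T n \<subseteq> verts (H n) \<rightarrow>\<^sub>E gball X p (real (D n))"
    proof
      fix \<psi> assume \<psi>: "\<psi> \<in> T n"
      have "\<psi> x \<in> gball X p (real (D n))" if x: "x \<in> verts (H n)" for x
      proof -
        have "gdist X (\<psi> (P n)) (\<psi> x) = gdist (H n) (P n) x" "\<psi> x \<in> verts X" "\<psi> (P n) = p"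
          using \<psi> x P_verts by (auto simp: T_def)
        then show ?thesis using D[OF x] by (simp add: gball_def)
      qed
      then show "\<psi> \<in> verts (H n) \<rightarrow>\<^sub>E gball X p (real (D n))" using \<psi> by (auto simp: T_def PiE_def)
    qed
    show "finite (verts (H n) \<rightarrow>\<^sub>E gball X p (real (D n)))" using finite_H X_ball(1)[OF D_pos] by (intro finite_PiE) auto
  qed
  have T_ne: "T n \<noteq> {}" for n
  proof -
    obtain M where M: "\<forall>m\<ge>M. \<exists>\<phi>. bij_betw \<phi> (gball (H m) (P m) (real (D n))) (gball X p (real (D n))) \<and>
      (\<forall>u\<in>gball (H m) (P m) (real (D n)). \<forall>v\<in>gball (H m) (P m) (real (D n)).
         gdist X (\<phi> u) (\<phi> v) = gdist (H m) u v) \<and> \<phi> (P m) = p"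
      using lim[OF D_pos[of n]] by blast
    obtain \<phi> where \<phi>: "bij_betw \<phi> (gball (H (n + M)) (P (n + M)) (real (D n))) (gball X p (real (D n)))"
      "\<And>u v. u \<in> gball (H (n + M)) (P (n + M)) (real (D n)) \<Longrightarrow>
        v \<in> gball (H (n + M)) (P (n + M)) (real (D n)) \<Longrightarrow> gdist X (\<phi> u) (\<phi> v) = gdist (H (n + M)) u v"
      "\<phi> (P (n + M)) = p"
      using M[rule_format, of "n + M"] by auto
    have in_ball: "(e ^^ M) x \<in> gball (H (n + M)) (P (n + M)) (real (D n))" if "x \<in> verts (H n)" for x
      using funpow_e(1)[OF that, of M] funpow_e(2)[OF P_verts that, of M] funpow_e(3)[of M n] D[OF that]
      by (simp add: gball_def)
    have "\<phi> ((e ^^ M) x) \<in> verts X" if "x \<in> verts (H n)" for x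
      using bij_betwE[OF \<phi>(1)] in_ball[OF that] by (auto simp: gball_def)
    moreover have "gdist X (\<phi> ((e ^^ M) x)) (\<phi> ((e ^^ M) y)) = gdist (H n) x y"
      if "x \<in> verts (H n)" "y \<in> verts (H n)" for x y
      using \<phi>(2)[OF in_ball[OF that(1)] in_ball[OF that(2)]] funpow_e(2)[OF that] by simp
    ultimately have "(\<lambda>x\<in>verts (H n). \<phi> ((e ^^ M) x)) \<in> T n"
      using P_verts \<phi>(3) funpow_e(3)[of M n] by (simp add: T_def)
    then show ?thesis by blast
  qed
  define \<rho> where "\<rho> n \<psi> = (\<lambda>x\<in>verts (H n). \<psi> (e x))" for n and \<psi> :: "'a \<Rightarrow> 'v"
  have \<rho>_T: "\<rho> n \<psi> \<in> T n" if "\<psi> \<in> T (Suc n)" for n \<psi>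
    using that e_verts e_iso P_verts P_Suc[of n] by (auto simp: T_def \<rho>_def PiE_iff)
  obtain s where s: "\<And>n. s n \<in> T n" "\<And>n. \<rho> n (s (Suc n)) = s n"
    by (rule inverse_limit_nonempty[of T \<rho>, OF T_fin T_ne \<rho>_T]) (assumption, rule that)
  have s_verts: "s n x \<in> verts X" if "x \<in> verts (H n)" for n x
    using s(1)[of n] that by (auto simp: T_def)
  have s_iso: "gdist X (s n x) (s n y) = gdist (H n) x y" if "x \<in> verts (H n)" "y \<in> verts (H n)" for n x y
    using s(1)[of n] that by (auto simp: T_def)
  have s_p: "s n (P n) = p" for n using s(1)[of n] by (simp add: T_def)
  have s_coh: "s (Suc n) (e x) = s n x" if "x \<in> verts (H n)" for n x
    using fun_cong[OF s(2)[of n], of x] that by (simp add: \<rho>_def)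
  have "y \<in> (\<Union>n. s n ` verts (H n))" if y: "y \<in> verts X" for y
  proof -
    define n where "n = Suc (gdist X p y)"
    have "1 \<le> n" by (simp add: n_def)
    have inj: "inj_on (s n) (gball (H n) (P n) (real n))"
    proof (rule inj_onI)
      fix a b assume ab: "a \<in> gball (H n) (P n) (real n)" "b \<in> gball (H n) (P n) (real n)" "s n a = s n b"
      then have "gdist (H n) a b = 0" using s_iso[of a n b] by (simp add: gball_def)
      then show "a = b" using gdist_eq_0[OF conn_H] ab by (auto simp: gball_def)
    qed
    have "s n ` gball (H n) (P n) (real n) \<subseteq> gball X p (real n)"
    proof
      fix z assume "z \<in> s n ` gball (H n) (P n) (real n)"
      then obtain a where a: "z = s n a" "a \<in> verts (H n)" "gdist (H n) (P n) a \<le> n"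
        by (auto simp: gball_def)
      then show "z \<in> gball X p (real n)"
        using s_verts s_iso[OF P_verts a(2)] by (simp add: gball_def s_p)
    qed
    moreover have "card (s n ` gball (H n) (P n) (real n)) = card (gball X p (real n))"
      using card_image[OF inj] X_ball(2)[OF \<open>1 \<le> n\<close>, of n] by simp
    ultimately have "s n ` gball (H n) (P n) (real n) = gball X p (real n)"
      using X_ball(1)[OF \<open>1 \<le> n\<close>] by (intro card_subset_eq)
    moreover have "y \<in> gball X p (real n)" using y by (simp add: gball_def n_def)
    ultimately have "y \<in> s n ` gball (H n) (P n) (real n)" by simp
    then show ?thesis by (auto simp: gball_def)
  qed
  then have "(\<Union>n. s n ` verts (H n)) = verts X" using s_verts by blast
  with s_verts s_iso s_coh show ?thesis by (rule that)
qed

end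

section \<open>Words, vertices and copies\<close>

lemma min_add_diff_le:
  fixes a b :: int
  assumes "\<bar>a - a'\<bar> \<le> D" "\<bar>b - b'\<bar> \<le> D"
  shows "\<bar>min (a + x) (b + y) - min (a' + x) (b' + y)\<bar> \<le> D"
  using assms by linarith

locale sierpinski =
  fixes r :: nat
  assumes r_ge_3: "3 \<le> r" and not_4_dvd: "\<not> 4 dvd r"
begin

abbreviation f :: nat where "f \<equiv> fshift r"
abbreviation S :: "(nat list \<times> nat list) set" where "S \<equiv> same_vertex r"
abbreviation V :: "nat list \<Rightarrow> nat list set" where "V \<equiv> sierp_vertex r"
abbreviation W :: "nat \<Rightarrow> nat list set" where "W \<equiv> sierp_words r"
abbreviation \<Gamma> :: "nat \<Rightarrow> nat list set graph" where "\<Gamma> \<equiv> sierp_graph r"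

abbreviation dd :: "nat \<Rightarrow> nat list \<Rightarrow> nat list \<Rightarrow> int" where
  "dd n u v \<equiv> int (gdist (\<Gamma> n) (V u) (V v))"

text \<open>The letter is reduced modulo \<open>r\<close>, so that corners can be written with sums of letters.\<close>

definition corner :: "nat \<Rightarrow> nat \<Rightarrow> nat list" where
  "corner n a = replicate n (a mod r)"

lemma fshift_eq: "f = r div 4 + 1"
  unfolding fshift_def by (rule Least_equality) auto

lemma f_bounds: "1 \<le> f" "2 * f < r" "r < 4 * f"
  unfolding fshift_eq using r_ge_3 not_4_dvd by presburger+

lemma r_pos: "0 < r" using r_ge_3 by simp

lemma mod_r_less [simp]: "a mod r < r" using r_pos by simp

lemma S_words: "(u, v) \<in> S \<Longrightarrow> length u = length v \<and> set u \<subseteq> {..<r} \<and> set v \<subseteq> {..<r}"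
  by (induction rule: same_vertex.induct) (auto simp: set_replicate_conv_if)

lemma S_length_1:
  assumes "(u, v) \<in> S" "length u = 1"
  shows "u = v"
  using assms
proof (induction rule: same_vertex.induct)
  case (sym u v)
  then show ?case using S_words by fastforce
next
  case (trans u v w)
  then show ?case using S_words by fastforce
next
  case (copy u v i)
  then show ?case using S_words[OF copy(1)] by simp
qed auto

lemma W_iff: "u \<in> W n \<longleftrightarrow> length u = n \<and> set u \<subseteq> {..<r}"
  by (simp add: sierp_words_def)

lemma W_Suc: "u @ [i] \<in> W (Suc n) \<longleftrightarrow> u \<in> W n \<and> i < r"
  by (auto simp: W_iff)

lemma W_SucE:
  assumes "w \<in> W (Suc n)"
  obtains u i where "w = u @ [i]" "u \<in> W n" "i < r"
proof (cases w rule: rev_cases)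
  case Nil
  then show ?thesis using assms by (simp add: W_iff)
next
  case (snoc u i)
  then show ?thesis using assms that by (simp add: W_Suc)
qed

lemma corner_W [simp]: "corner n a \<in> W n"
  by (auto simp: corner_def W_iff set_replicate_conv_if)

lemma corner_Suc: "corner (Suc n) a = corner n a @ [a mod r]"
  by (simp add: corner_def replicate_append_same)

lemma corner_mod: "a mod r = b mod r \<Longrightarrow> corner n a = corner n b"
  by (simp add: corner_def)

lemma V_eq:
  assumes "(u, v) \<in> S"
  shows "V u = V v"
proof -
  have "(u, x) \<in> S \<longleftrightarrow> (v, x) \<in> S" for x
    using same_vertex.trans[OF assms, of x] same_vertex.trans[OF same_vertex.sym[OF assms], of x]
    by (rule iffI[rotated])
  then show ?thesis by (simp add: sierp_vertex_def Image_def)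
qed

lemma V_iff: "x \<in> V u \<longleftrightarrow> (u, x) \<in> S"
  by (simp add: sierp_vertex_def)

lemma V_self: "u \<in> W n \<Longrightarrow> u \<in> V u"
  unfolding V_iff W_iff by (rule same_vertex.refl) simp

lemma V_eq_iff: "v \<in> W n \<Longrightarrow> V u = V v \<longleftrightarrow> (u, v) \<in> S"
  using V_eq[of u v] V_self[of v n] V_iff[of v u] by metis

lemma verts_\<Gamma>: "verts (\<Gamma> n) = V ` W n"
  by (auto simp: sierp_graph_def quotient_def sierp_vertex_def)

lemma V_in_verts [simp]: "u \<in> W n \<Longrightarrow> V u \<in> verts (\<Gamma> n)"
  by (simp add: verts_\<Gamma>)

lemma edges_\<Gamma>: "edges (\<Gamma> n) = {(V u, V v) | u v. (u, v) \<in> word_edges r \<and> length u = n}"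
  by (simp add: sierp_graph_def)

lemma word_edges_words:
  "(u, v) \<in> word_edges r \<Longrightarrow> length u = length v \<and> u \<noteq> [] \<and> set u \<subseteq> {..<r} \<and> set v \<subseteq> {..<r}"
  by (induction rule: word_edges.induct) auto

lemma word_edges_sym: "(u, v) \<in> word_edges r \<Longrightarrow> (v, u) \<in> word_edges r"
proof (induction rule: word_edges.induct)
  case (cycle_succ i)
  then show ?case by (rule word_edges.cycle_pred)
next
  case (cycle_pred i)
  then show ?case by (rule word_edges.cycle_succ)
next
  case (copy u v i)
  then show ?case by (intro word_edges.copy)
qed

text \<open>The identification of the copies \<open>i\<close> and \<open>i + 1\<close>, for letters that are not yet reduced modulo \<open>r\<close>.\<close>

lemma glue_S:
  assumes "1 \<le> n"
  shows "(corner n (i + f) @ [i mod r], corner n (i + 1 + 2 * f) @ [(i + 1) mod r]) \<in> S"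
proof -
  have "(i mod r + f) mod r = (i + f) mod r" "(i mod r + 1 + 2 * f) mod r = (i + 1 + 2 * f) mod r"
    "(i mod r + 1) mod r = (i + 1) mod r"
    using mod_add_left_eq[of i r f] mod_add_left_eq[of i r "1 + 2 * f"] mod_add_left_eq[of i r 1]
    by (simp_all only: add.assoc)
  then show ?thesis
    using same_vertex.glue[of n "i mod r" r] assms by (simp only: corner_def fshift2_def) simp
qed

lemma glue_V:
  "1 \<le> n \<Longrightarrow> V (corner n (i + f) @ [i mod r]) = V (corner n (i + 1 + 2 * f) @ [(i + 1) mod r])"
  by (rule V_eq) (rule glue_S)

text \<open>The inclusion of the copy with letter \<open>i\<close>, on equivalence classes of words.\<close>

definition emb :: "nat \<Rightarrow> nat list set \<Rightarrow> nat list set" where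
  "emb i C = S `` ((\<lambda>u. u @ [i]) ` C)"

lemma emb_V:
  assumes "u \<in> W n" "i < r"
  shows "emb i (V u) = V (u @ [i])"
proof (intro set_eqI iffI)
  fix x assume "x \<in> emb i (V u)"
  then obtain v where "(u, v) \<in> S" "(v @ [i], x) \<in> S"
    by (auto simp: emb_def sierp_vertex_def)
  then have "(u @ [i], x) \<in> S"
    using same_vertex.copy[OF _ assms(2)] same_vertex.trans by blast
  then show "x \<in> V (u @ [i])" by (simp add: sierp_vertex_def)
next
  fix x assume "x \<in> V (u @ [i])"
  then show "x \<in> emb i (V u)"
    using V_self[OF assms(1)] unfolding emb_def by (auto simp: sierp_vertex_def)
qed

lemma edges_emb:
  assumes "(x, y) \<in> edges (\<Gamma> n)" "i < r"
  shows "(emb i x, emb i y) \<in> edges (\<Gamma> (Suc n))"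
proof -
  obtain u v where uv: "x = V u" "y = V v" "(u, v) \<in> word_edges r" "length u = n"
    using assms(1) by (auto simp: edges_\<Gamma>)
  then have "u \<in> W n" "v \<in> W n" using word_edges_words by (auto simp: W_iff)
  then have "emb i x = V (u @ [i])" "emb i y = V (v @ [i])" using uv emb_V assms(2) by auto
  moreover have "(u @ [i], v @ [i]) \<in> word_edges r" using uv assms(2) by (intro word_edges.copy)
  ultimately show ?thesis using uv(4) unfolding edges_\<Gamma> by fastforce
qed

lemma edge_V: "(u, v) \<in> word_edges r \<Longrightarrow> length u = n \<Longrightarrow> (V u, V v) \<in> edges (\<Gamma> n)"
  by (auto simp: edges_\<Gamma>)

lemma sym_edges_\<Gamma>: "sym (edges (\<Gamma> n))"
proof (rule symI)
  fix x y assume "(x, y) \<in> edges (\<Gamma> n)"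
  then obtain u v where uv: "x = V u" "y = V v" "(u, v) \<in> word_edges r" "length u = n"
    by (auto simp: edges_\<Gamma>)
  then show "(y, x) \<in> edges (\<Gamma> n)"
    using word_edges_words[OF uv(3)] by (auto intro!: edge_V word_edges_sym)
qed

lemma edges_\<Gamma>_verts: "edges (\<Gamma> n) \<subseteq> verts (\<Gamma> n) \<times> verts (\<Gamma> n)"
  using word_edges_words by (force simp: edges_\<Gamma> verts_\<Gamma> W_iff)

lemma walk_connected_\<Gamma>: "1 \<le> n \<Longrightarrow> walk_connected (\<Gamma> n)"
proof (induction n rule: nat_induct_at_least)
  case base
  have star: "(V [0], V [a]) \<in> (edges (\<Gamma> 1))\<^sup>*" if "a < r" for a
    using that
  proof (induction a)
    case (Suc a)
    have "([a], [(a + 1) mod r]) \<in> word_edges r" using Suc.prems by (intro word_edges.cycle_succ) simp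
    then have "(V [a], V [Suc a]) \<in> edges (\<Gamma> 1)" using Suc.prems by (intro edge_V) auto
    with Suc show ?case by (meson Suc_lessD rtrancl_into_rtrancl)
  qed simp
  have "(V u, V v) \<in> (edges (\<Gamma> 1))\<^sup>*" if uv: "u \<in> W 1" "v \<in> W 1" for u v
  proof -
    obtain a b where "u = [a]" "v = [b]" "a < r" "b < r"
      using uv by (auto simp: W_iff length_Suc_conv)
    then have "(V u, V [0]) \<in> (edges (\<Gamma> 1))\<^sup>*" "(V [0], V v) \<in> (edges (\<Gamma> 1))\<^sup>*"
      using star sym_rtrancl[OF sym_edges_\<Gamma>] by (auto dest: symD)
    then show ?thesis by (rule rtrancl_trans)
  qed
  then show ?case
    using sym_edges_\<Gamma> edges_\<Gamma>_verts by (auto simp: walk_connected_def verts_\<Gamma>)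
next
  case (Suc n)
  let ?E = "edges (\<Gamma> (Suc n))"
  have copy: "(V (u @ [i]), V (v @ [i])) \<in> ?E\<^sup>*" if "u \<in> W n" "v \<in> W n" "i < r" for u v i
  proof -
    have "(V u, V v) \<in> (edges (\<Gamma> n))\<^sup>*" using Suc.IH that by (auto simp: walk_connected_def)
    then have "(emb i (V u), emb i (V v)) \<in> ?E\<^sup>*"
      by (rule rtrancl_homomorphic) (rule edges_emb[OF _ that(3)])
    then show ?thesis using that by (simp add: emb_V)
  qed
  have star: "(V (corner n 0 @ [0]), V (u @ [i])) \<in> ?E\<^sup>*" if "u \<in> W n" "i < r" for u i
    using that
  proof (induction i arbitrary: u)
    case 0
    then show ?case using copy corner_W by blast
  next
    case (Suc i)
    have "(V (corner n 0 @ [0]), V (corner n (i + f) @ [i mod r])) \<in> ?E\<^sup>*"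
      using Suc.IH[of "corner n (i + f)"] Suc.prems by simp
    moreover have "(V (corner n (i + 1 + 2 * f) @ [(i + 1) mod r]), V (u @ [Suc i])) \<in> ?E\<^sup>*"
      using copy[of "corner n (i + 1 + 2 * f)" u "Suc i"] Suc.prems by simp
    ultimately show ?case using glue_V[OF Suc.hyps, of i] by simp
  qed
  have "(x, y) \<in> ?E\<^sup>*" if xy: "x \<in> verts (\<Gamma> (Suc n))" "y \<in> verts (\<Gamma> (Suc n))" for x y
  proof -
    have "(V (corner n 0 @ [0]), z) \<in> ?E\<^sup>*" if "z \<in> verts (\<Gamma> (Suc n))" for z
      using that star unfolding verts_\<Gamma> by (auto elim!: W_SucE)
    then have "(x, V (corner n 0 @ [0])) \<in> ?E\<^sup>*" "(V (corner n 0 @ [0]), y) \<in> ?E\<^sup>*"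
      using sym_rtrancl[OF sym_edges_\<Gamma>] xy by (auto dest: symD)
    then show ?thesis by (rule rtrancl_trans)
  qed
  then show ?case
    using sym_edges_\<Gamma> edges_\<Gamma>_verts by (auto simp: walk_connected_def)
qed

lemma dd_commute: "1 \<le> n \<Longrightarrow> dd n u v = dd n v u"
  using gdist_commute[OF walk_connected_\<Gamma>] by simp

lemma dd_triangle:
  "1 \<le> n \<Longrightarrow> u \<in> W n \<Longrightarrow> v \<in> W n \<Longrightarrow> w \<in> W n \<Longrightarrow> dd n u w \<le> dd n u v + dd n v w"
  using gdist_triangle[OF walk_connected_\<Gamma>, of n "V u" "V v" "V w"] by simp

lemma dd_copy_le:
  assumes "1 \<le> n" "u \<in> W n" "v \<in> W n" "i < r"
  shows "dd (Suc n) (u @ [i]) (v @ [i]) \<le> dd n u v"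
proof -
  have walk: "(emb i x, emb i y) \<in> edges (\<Gamma> (Suc n)) ^^ k" if "(x, y) \<in> edges (\<Gamma> n) ^^ k" for x y k
    using that
  proof (induction k arbitrary: y)
    case (Suc k)
    then obtain z where z: "(x, z) \<in> edges (\<Gamma> n) ^^ k" "(z, y) \<in> edges (\<Gamma> n)" by auto
    show ?case using Suc.IH[OF z(1)] edges_emb[OF z(2) assms(4)] by auto
  qed simp
  have "(V u, V v) \<in> edges (\<Gamma> n) ^^ gdist (\<Gamma> n) (V u) (V v)"
    using assms by (intro gdist_walk walk_connected_\<Gamma>) auto
  from gdist_le[OF walk[OF this]] show ?thesis using assms by (simp add: emb_V)
qed

lemma lipI:
  fixes F :: "nat list \<Rightarrow> int"
  assumes n: "1 \<le> n"
    and S: "\<And>u v. (u, v) \<in> S \<Longrightarrow> length u = n \<Longrightarrow> F u = F v"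
    and E: "\<And>u v. (u, v) \<in> word_edges r \<Longrightarrow> length u = n \<Longrightarrow> \<bar>F u - F v\<bar> \<le> 1"
    and uv: "u \<in> W n" "v \<in> W n"
  shows "\<bar>F u - F v\<bar> \<le> dd n u v"
proof -
  define F' where "F' C = F (SOME w. w \<in> C)" for C
  have F': "F' (V w) = F w" if "w \<in> W n" for w
  proof -
    have "(SOME x. x \<in> V w) \<in> V w" using V_self[OF that] by (rule someI)
    then have "F w = F (SOME x. x \<in> V w)"
      using that by (intro S) (simp_all add: sierp_vertex_def W_iff)
    then show ?thesis by (simp add: F'_def)
  qed
  have "\<bar>F' x - F' y\<bar> \<le> 1" if xy: "(x, y) \<in> edges (\<Gamma> n)" for x y
  proof -
    obtain a b where ab: "x = V a" "y = V b" "(a, b) \<in> word_edges r" "length a = n"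
      using xy by (auto simp: edges_\<Gamma>)
    then have "a \<in> W n" "b \<in> W n" using word_edges_words by (auto simp: W_iff)
    then show ?thesis using ab E F' by simp
  qed
  moreover have "(V u, V v) \<in> edges (\<Gamma> n) ^^ gdist (\<Gamma> n) (V u) (V v)"
    using n uv by (intro gdist_walk walk_connected_\<Gamma>) auto
  ultimately have "\<bar>F' (V u) - F' (V v)\<bar> \<le> dd n u v"
    by (rule lipschitz_relpow)
  then show ?thesis using F' uv by simp
qed

text \<open>A function on the ring of copies is 1-Lipschitz if it is so on every copy and its values at glued
  labels agree. That it is compatible with \<open>same_vertex\<close> follows by induction over the rules, where
  identifications inside a copy are the case of distance 0.\<close>

lemma lip_step:
  fixes F :: "nat list \<Rightarrow> int"
  assumes n: "1 \<le> n"
    and copies: "\<And>i u v. i < r \<Longrightarrow> u \<in> W n \<Longrightarrow> v \<in> W n \<Longrightarrow> \<bar>F (u @ [i]) - F (v @ [i])\<bar> \<le> dd n u v"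
    and glue: "\<And>i. i < r \<Longrightarrow>
      F (corner n (i + f) @ [i]) = F (corner n (i + 1 + 2 * f) @ [(i + 1) mod r])"
    and uv: "u \<in> W (Suc n)" "v \<in> W (Suc n)"
  shows "\<bar>F u - F v\<bar> \<le> dd (Suc n) u v"
proof (rule lipI)
  show "F x = F y" if "(x, y) \<in> S" "length x = Suc n" for x y
    using that
  proof (induction rule: same_vertex.induct)
    case (sym x y)
    then show ?case using S_words by fastforce
  next
    case (trans x y z)
    then show ?case using S_words by fastforce
  next
    case (copy x y i)
    then have "x \<in> W n" "y \<in> W n" using S_words by (auto simp: W_iff)
    then show ?case using copies[of i x y] copy V_eq[of x y] by simp
  next
    case (glue m i)
    then have "m = n" by simp
    with glue assms(3)[OF glue(2)] show ?case by (simp add: corner_def fshift2_def)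
  qed simp
  show "\<bar>F x - F y\<bar> \<le> 1" if "(x, y) \<in> word_edges r" "length x = Suc n" for x y
    using that
  proof (cases rule: word_edges.cases)
    case (copy a b i)
    then have a: "length a = n" using that(2) by simp
    then have "a \<in> W n" "b \<in> W n" using word_edges_words[OF copy(3)] by (auto simp: W_iff)
    then have "\<bar>F x - F y\<bar> \<le> dd n a b" using copies copy by simp
    also have "\<dots> \<le> 1" using gdist_edge[OF edge_V[OF copy(3) a]] by simp
    finally show ?thesis .
  qed (use n that in auto)
qed (use uv in auto)

section \<open>Distances in a ring of copies\<close>

lemma dd_diff_le:
  assumes "1 \<le> n" "u \<in> W n" "v \<in> W n" "w \<in> W n"
  shows "\<bar>dd n u w - dd n v w\<bar> \<le> dd n u v"
  using dd_triangle[OF assms(1,2,3,4)] dd_triangle[OF assms(1,3,2,4)] dd_commute[OF assms(1), of u v]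
  by linarith

text \<open>The position of the letter \<open>i\<close> in the ring when counting starts at \<open>q\<close>.\<close>

definition offset :: "nat \<Rightarrow> nat \<Rightarrow> nat" where
  "offset q i = (i + (r - q mod r)) mod r"

lemma offset_add: "t < r \<Longrightarrow> offset q ((q + t) mod r) = t"
proof -
  assume t: "t < r"
  have "offset q ((q + t) mod r) = (q + t + (r - q mod r)) mod r"
    by (simp add: offset_def mod_add_left_eq)
  also have "\<dots> = (q mod r + (t + (r - q mod r))) mod r"
    by (simp add: add.assoc mod_add_left_eq)
  also have "q mod r + (t + (r - q mod r)) = t + r"
    using mod_r_less[of q] by linarith
  finally show ?thesis using t by simp
qed

lemma offset_less [simp]: "offset q i < r"
  by (simp add: offset_def)

lemma add_offset: "i < r \<Longrightarrow> (q + offset q i) mod r = i"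
proof -
  assume i: "i < r"
  have "(q + offset q i) mod r = (q mod r + (i + (r - q mod r))) mod r"
    by (simp add: offset_def mod_simps)
  also have "q mod r + (i + (r - q mod r)) = i + r"
    using mod_r_less[of q] by linarith
  finally show ?thesis using i by simp
qed

lemma offset_cases:
  assumes "i < r"
  obtains t where "t < r" "i = (q + t) mod r"
  using that[of "offset q i"] add_offset[OF assms] by simp

text \<open>The number \<open>g t\<close> is the value prescribed at the vertex shared by the copies \<open>q + t\<close> and \<open>q + t + 1\<close>.
  On a copy other than \<open>q\<close> the extension is the largest 1-Lipschitz function with the prescribed values
  at the two shared vertices. It takes these values because they differ by at most the distance \<open>L\<close>
  of the two vertices.\<close>

lemma ring_extension:
  fixes \<Phi> :: "nat list \<Rightarrow> int" and g :: "nat \<Rightarrow> int"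
  assumes n: "1 \<le> n"
    and gap: "\<And>i. dd n (corner n (i + f)) (corner n (i + 2 * f)) = L"
    and \<Phi>: "\<And>u v. u \<in> W n \<Longrightarrow> v \<in> W n \<Longrightarrow> \<bar>\<Phi> u - \<Phi> v\<bar> \<le> dd n u v"
    and g_first: "g 0 = \<Phi> (corner n (q + f))"
    and g_last: "g (r - 1) = \<Phi> (corner n (q + 2 * f))"
    and g_step: "\<And>t. Suc t < r \<Longrightarrow> \<bar>g (Suc t) - g t\<bar> \<le> L"
  obtains F where "\<And>u v. u \<in> W (Suc n) \<Longrightarrow> v \<in> W (Suc n) \<Longrightarrow> \<bar>F u - F v\<bar> \<le> dd (Suc n) u v"
    and "\<And>u. F (u @ [q mod r]) = \<Phi> u"
    and "\<And>u t. Suc t < r \<Longrightarrow> F (u @ [(q + Suc t) mod r]) =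
      min (dd n u (corner n (q + Suc t + f)) + g (Suc t)) (dd n u (corner n (q + Suc t + 2 * f)) + g t)"
proof -
  \<comment> \<open>the copy \<open>q\<close> has position 0; a letter at position \<open>t > 0\<close> selects the copy between \<open>g (t - 1)\<close> and \<open>g t\<close>\<close>
  define F where "F w = (let u = butlast w; t = offset q (last w) in if t = 0 then \<Phi> u else
    min (dd n u (corner n (q + t + f)) + g t) (dd n u (corner n (q + t + 2 * f)) + g (t - 1)))" for w
  have F: "F (u @ [(q + t) mod r]) = (if t = 0 then \<Phi> u else
    min (dd n u (corner n (q + t + f)) + g t) (dd n u (corner n (q + t + 2 * f)) + g (t - 1)))"
    if "t < r" for u t
    using offset_add[OF that] by (simp add: F_def Let_def)
  have F0: "F (u @ [q mod r]) = \<Phi> u" for u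
    using F[of 0 u] r_pos by simp
  have right: "F (corner n (q + t + f) @ [(q + t) mod r]) = g t" if t: "t < r" for t
  proof (cases t)
    case 0
    then show ?thesis using F[OF t] g_first by simp
  next
    case (Suc s)
    have "\<bar>g (Suc s) - g s\<bar> \<le> L" using g_step t Suc by simp
    then show ?thesis using F[OF t, of "corner n (q + t + f)"] gap[of "q + t"] Suc by simp
  qed
  have left: "F (corner n (q + Suc t + 2 * f) @ [(q + Suc t) mod r]) = g t" if t: "Suc t < r" for t
    using F[OF t, of "corner n (q + Suc t + 2 * f)"] gap[of "q + Suc t"] g_step[OF t]
      dd_commute[OF n, of "corner n (q + Suc t + f)" "corner n (q + Suc t + 2 * f)"]
    by (simp del: of_nat_Suc)
  have lip: "\<bar>F u - F v\<bar> \<le> dd (Suc n) u v" if uv: "u \<in> W (Suc n)" "v \<in> W (Suc n)" for u v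
  proof (rule lip_step[OF n _ _ uv])
    fix i u v assume i: "i < r" and uv: "u \<in> W n" "v \<in> W n"
    obtain t where t: "t < r" "i = (q + t) mod r" using offset_cases[OF i] .
    show "\<bar>F (u @ [i]) - F (v @ [i])\<bar> \<le> dd n u v"
    proof (cases "t = 0")
      case True
      then show ?thesis using \<Phi>[OF uv] F[OF t(1)] t(2) by simp
    next
      case False
      have "\<bar>dd n u (corner n k) - dd n v (corner n k)\<bar> \<le> dd n u v" for k
        using dd_diff_le[OF n uv] corner_W by blast
      then show ?thesis
        unfolding t(2) F[OF t(1)] using False by (simp only: if_False min_add_diff_le)
    qed
  next
    fix i assume i: "i < r"
    obtain t where t: "t < r" "i = (q + t) mod r" using offset_cases[OF i] .
    have c: "corner n (i + f) = corner n (q + t + f)"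
      by (rule corner_mod) (simp add: t(2) mod_add_left_eq)
    have c': "corner n (i + 1 + 2 * f) = corner n (q + Suc t + 2 * f)"
    proof (rule corner_mod)
      show "(i + 1 + 2 * f) mod r = (q + Suc t + 2 * f) mod r"
        using mod_add_left_eq[of "q + t" r "1 + 2 * f"] by (simp add: t(2))
    qed
    have i': "(i + 1) mod r = (q + Suc t) mod r"
      using mod_add_left_eq[of "q + t" r 1] by (simp add: t(2))
    show "F (corner n (i + f) @ [i]) = F (corner n (i + 1 + 2 * f) @ [(i + 1) mod r])"
    proof (cases "Suc t < r")
      case True
      show ?thesis unfolding c c' i' left[OF True] using right[OF t(1)] t(2) by simp
    next
      case False
      then have r: "r = Suc t" using t(1) by simp
      then have "(q + Suc t) mod r = q mod r" "corner n (q + Suc t + 2 * f) = corner n (q + 2 * f)"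
        by (auto intro!: corner_mod simp: add.assoc add.left_commute[of q] simp flip: r)
      moreover have "g t = \<Phi> (corner n (q + 2 * f))" using g_last r by simp
      ultimately show ?thesis unfolding c c' i' using right[OF t(1)] F0 t(2) by simp
    qed
  qed
  have "F (u @ [(q + Suc t) mod r]) =
      min (dd n u (corner n (q + Suc t + f)) + g (Suc t)) (dd n u (corner n (q + Suc t + 2 * f)) + g t)"
    if "Suc t < r" for u t
    using F[OF that, of u] by simp
  from that[OF lip F0 this] show ?thesis .
qed

text \<open>The distance from \<open>v\<close>, as a function on the copy \<open>i\<close>, extends to the ring: it has the value \<open>a\<close> at one
  of the two shared vertices and \<open>b\<close> at the other, and \<open>\<bar>a - b\<bar> \<le> L\<close>. The value \<open>a\<close> is kept on all
  further shared vertices, and the whole change to \<open>b\<close> takes place in the last copy.\<close>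

lemma copy_isometric:
  assumes n: "1 \<le> n"
    and gap: "\<And>i. dd n (corner n (i + f)) (corner n (i + 2 * f)) = L"
    and uv: "u \<in> W n" "v \<in> W n" "i < r"
  shows "dd (Suc n) (u @ [i]) (v @ [i]) = dd n u v"
proof (rule antisym)
  show "dd (Suc n) (u @ [i]) (v @ [i]) \<le> dd n u v" using n uv by (rule dd_copy_le)
  define a where "a = dd n (corner n (i + f)) v"
  define b where "b = dd n (corner n (i + 2 * f)) v"
  have ab: "\<bar>a - b\<bar> \<le> L" unfolding a_def b_def gap[of i, symmetric]
    using n uv(2) by (intro dd_diff_le) auto
  have "0 \<le> L" using gap[of 0] by linarith
  obtain F where F: "\<And>u v. u \<in> W (Suc n) \<Longrightarrow> v \<in> W (Suc n) \<Longrightarrow> \<bar>F u - F v\<bar> \<le> dd (Suc n) u v"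
    "\<And>u. F (u @ [i mod r]) = dd n u v"
  proof (rule ring_extension[OF n gap, where q = i and \<Phi> = "\<lambda>u. dd n u v"
        and g = "\<lambda>t. if t = r - 1 then b else a"])
    show "\<bar>dd n x v - dd n y v\<bar> \<le> dd n x y" if "x \<in> W n" "y \<in> W n" for x y
      using dd_diff_le[OF n that uv(2)] .
    show "(if 0 = r - 1 then b else a) = dd n (corner n (i + f)) v"
      using r_ge_3 by (simp add: a_def)
    show "(if r - 1 = r - 1 then b else a) = dd n (corner n (i + 2 * f)) v"
      by (simp add: b_def)
    show "\<bar>(if Suc t = r - 1 then b else a) - (if t = r - 1 then b else a)\<bar> \<le> L" if "Suc t < r" for t
      using ab \<open>0 \<le> L\<close> that by auto
  qed (rule that)
  have "F (u @ [i]) - F (v @ [i]) = dd n u v" using F(2)[of u] F(2)[of v] uv(3) by simp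
  then show "dd n u v \<le> dd (Suc n) (u @ [i]) (v @ [i])"
    using F(1)[of "u @ [i]" "v @ [i]"] uv by (simp add: W_Suc)
qed

text \<open>\<open>gapL n\<close> is the distance between the corners \<open>a\<close> and \<open>a + f\<close> of level \<open>n\<close>, and \<open>gapM n\<close> that
  between \<open>a\<close> and \<open>a + 2f\<close>.\<close>

fun gapL gapM :: "nat \<Rightarrow> int" where
  "gapL 0 = 1"
| "gapM 0 = 0"
| "gapL (Suc n) = int f * gapL n + gapM n"
| "gapM (Suc n) = (int r - 2 * int f) * gapL n + gapM n"

text \<open>These inequalities decide which way round the ring is shorter. The last one expresses that the way
  from \<open>A\<^sub>n\<close> to \<open>B\<^bsub>n+1\<^esub>\<close> through \<open>B\<^sub>n\<close> is not longer than the other one; it has content only for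
  \<open>r = 4f - 1\<close> (see also \<open>AB_tower\<close>).\<close>

lemma gap_inv:
  assumes "1 \<le> n"
  shows "0 < gapL n" "0 < gapM n" "gapM n \<le> 2 * gapL n" "gapM n \<le> (int r - 2 * int f) * gapL n"
    "(int r + 2 - 4 * int f) * gapL n \<le> gapM n"
proof -
  define k where "k = int r - 2 * int f"
  have k: "1 \<le> k" "k + 1 \<le> 2 * int f" using f_bounds by (auto simp: k_def)
  have f1: "1 \<le> int f" using f_bounds by simp
  have "0 < gapL n \<and> 0 < gapM n \<and> gapM n \<le> 2 * gapL n \<and> gapM n \<le> k * gapL n \<and>
      (k + 2 - 2 * int f) * gapL n \<le> gapM n"
    using assms
  proof (induction n rule: nat_induct_at_least)
    case base
    have *: "gapL 1 = int f" "gapM 1 = k" by (simp_all add: k_def)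
    have "k * 1 \<le> k * int f" using k f1 by (intro mult_left_mono) auto
    moreover have "(k + 2 - 2 * int f) * int f \<le> k"
    proof (cases "k + 1 = 2 * int f")
      case True
      then have one: "k + 2 - 2 * int f = 1" by simp
      show ?thesis unfolding one using True f1 by linarith
    next
      case False
      then have "(k + 2 - 2 * int f) * int f \<le> 0" using k f1 by (intro mult_nonpos_nonneg) auto
      then show ?thesis using k by linarith
    qed
    ultimately show ?case unfolding * using k f1 by auto
  next
    case (Suc n)
    then have L: "0 < gapL n" and M: "0 < gapM n" and I: "gapM n \<le> 2 * gapL n" "gapM n \<le> k * gapL n" by auto
    have eq: "gapL (Suc n) = int f * gapL n + gapM n" "gapM (Suc n) = k * gapL n + gapM n"
      by (simp_all add: k_def)
    have fL: "0 < int f * gapL n" and kL: "0 < k * gapL n" using L f1 k by simp_all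
    have "k * gapL n \<le> (2 * int f) * gapL n" using L k by (intro mult_right_mono) auto
    moreover have "k * gapL n + gapM n \<le> k * (int f * gapL n + gapM n)"
    proof -
      have "1 * gapL n \<le> int f * gapL n" using L f1 by (intro mult_right_mono) auto
      then have "k * gapL n \<le> k * (int f * gapL n)" using k by (intro mult_left_mono) auto
      moreover have "1 * gapM n \<le> k * gapM n" using M k by (intro mult_right_mono) auto
      ultimately show ?thesis by (simp add: distrib_left)
    qed
    moreover have "(k + 2 - 2 * int f) * (int f * gapL n + gapM n) \<le> k * gapL n + gapM n"
    proof (cases "k + 1 = 2 * int f")
      case True
      have "1 * gapL n \<le> int f * gapL n" using L f1 by (intro mult_right_mono) auto
      moreover have "k * gapL n = 2 * (int f * gapL n) - gapL n"
      proof -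
        have "k = 2 * int f - 1" using True by simp
        then show ?thesis by (simp add: left_diff_distrib)
      qed
      moreover have one: "k + 2 - 2 * int f = 1" using True by simp
      ultimately show ?thesis unfolding one mult_1 by linarith
    next
      case False
      then have "(k + 2 - 2 * int f) * (int f * gapL n + gapM n) \<le> 0"
        using k fL M by (intro mult_nonpos_nonneg) auto
      then show ?thesis using kL M by linarith
    qed
    ultimately show ?case unfolding eq using fL kL M by (auto simp: algebra_simps)
  qed
  moreover have "k + 2 - 2 * int f = int r + 2 - 4 * int f" by (simp add: k_def)
  ultimately show "0 < gapL n" "0 < gapM n" "gapM n \<le> 2 * gapL n"
    "gapM n \<le> (int r - 2 * int f) * gapL n" "(int r + 2 - 4 * int f) * gapL n \<le> gapM n"
    by (auto simp: k_def)
qed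

text \<open>A label of the vertex shared by the copies \<open>i\<close> and \<open>i + 1\<close>.\<close>

definition glue :: "nat \<Rightarrow> nat \<Rightarrow> nat list" where
  "glue n i = corner n (i + f) @ [i mod r]"

lemma glue_W [simp]: "glue n i \<in> W (Suc n)"
  by (simp add: glue_def W_Suc)

lemma glue_mod: "i mod r = j mod r \<Longrightarrow> glue n i = glue n j"
  unfolding glue_def by (metis corner_mod mod_add_left_eq)

lemma V_glue: "1 \<le> n \<Longrightarrow> V (glue n i) = V (corner n (i + 1 + 2 * f) @ [(i + 1) mod r])"
  unfolding glue_def by (rule glue_V)

text \<open>The induction hypothesis for the computation of distances.\<close>

definition corners_at :: "nat \<Rightarrow> bool" where
  "corners_at n \<longleftrightarrow> (\<forall>a. dd n (corner n a) (corner n (a + f)) = gapL n \<and>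
     dd n (corner n a) (corner n (a + 2 * f)) = gapM n)"

lemma corners_L: "corners_at n \<Longrightarrow> dd n (corner n a) (corner n (a + f)) = gapL n"
  and corners_M: "corners_at n \<Longrightarrow> dd n (corner n a) (corner n (a + 2 * f)) = gapM n"
  by (simp_all add: corners_at_def)

lemma corners_gap:
  assumes "corners_at n"
  shows "dd n (corner n (i + f)) (corner n (i + 2 * f)) = gapL n"
  using assms unfolding corners_at_def by (metis add.assoc mult_2)

lemma glue_step:
  assumes "1 \<le> n" "corners_at n"
  shows "dd (Suc n) (glue n i) (glue n (i + 1)) \<le> gapL n"
proof -
  have "dd (Suc n) (glue n i) (glue n (i + 1))
      = dd (Suc n) (corner n (i + 1 + 2 * f) @ [(i + 1) mod r]) (corner n (i + 1 + f) @ [(i + 1) mod r])"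
    using V_glue[OF assms(1), of i] by (simp add: glue_def)
  also have "\<dots> \<le> dd n (corner n (i + 1 + 2 * f)) (corner n (i + 1 + f))"
    using assms(1) by (intro dd_copy_le) auto
  also have "\<dots> = gapL n"
    using corners_gap[OF assms(2), of "i + 1"] dd_commute[OF assms(1)] by simp
  finally show ?thesis .
qed

lemma glue_steps:
  assumes "1 \<le> n" "corners_at n"
  shows "dd (Suc n) (glue n i) (glue n (i + k)) \<le> int k * gapL n"
proof (induction k)
  case (Suc k)
  have "dd (Suc n) (glue n i) (glue n (i + Suc k))
      \<le> dd (Suc n) (glue n i) (glue n (i + k)) + dd (Suc n) (glue n (i + k)) (glue n (i + Suc k))"
    by (rule dd_triangle) auto
  with Suc glue_step[OF assms, of "i + k"] show ?case by (simp add: algebra_simps)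
qed simp

lemma corner_glue_right:
  assumes "1 \<le> n" "corners_at n"
  shows "dd (Suc n) (corner (Suc n) i) (glue n i) \<le> gapL n"
proof -
  have "dd (Suc n) (corner (Suc n) i) (glue n i) \<le> dd n (corner n i) (corner n (i + f))"
    unfolding corner_Suc glue_def using assms(1) by (intro dd_copy_le) auto
  also have "\<dots> = gapL n" using assms(2) by (simp add: corners_at_def)
  finally show ?thesis .
qed

lemma glue_corner_left:
  assumes "1 \<le> n" "corners_at n"
  shows "dd (Suc n) (glue n i) (corner (Suc n) (i + 1)) \<le> gapM n"
proof -
  have "dd (Suc n) (glue n i) (corner (Suc n) (i + 1))
      \<le> dd n (corner n (i + 1 + 2 * f)) (corner n (i + 1))"
    unfolding corner_Suc V_glue[OF assms(1)] using assms(1) by (intro dd_copy_le) auto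
  also have "\<dots> = gapM n"
    using corners_M[OF assms(2), of "i + 1"]
      dd_commute[OF assms(1), of "corner n (i + 1 + 2 * f)" "corner n (i + 1)"] by simp
  finally show ?thesis .
qed

text \<open>From the corner \<open>q\<close> one can go round the ring in two directions, leaving the copy \<open>q\<close> after \<open>gapL n\<close> or
  \<open>gapM n\<close> steps and passing through each further copy in \<open>gapL n\<close> steps. The minimum \<open>g t\<close> of the two
  lengths is fed into \<open>ring_extension\<close>.\<close>

lemma corner_glue_lower:
  assumes n: "1 \<le> n" and C: "corners_at n"
  defines "g \<equiv> \<lambda>t. min ((int t + 1) * gapL n) (gapM n + (int r - 1 - int t) * gapL n)"
  shows "t < r \<Longrightarrow> g t \<le> dd (Suc n) (glue n (q + t)) (corner (Suc n) q)"
    and "Suc t < r \<Longrightarrow> min (gapL n + g (Suc t)) (gapM n + g t)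
      \<le> dd (Suc n) (corner (Suc n) (q + Suc t)) (corner (Suc n) q)"
proof -
  note inv = gap_inv[OF n]
  have rL: "2 * gapL n \<le> int r * gapL n" using inv r_ge_3 by (intro mult_right_mono) auto
  have g: "g t = min ((int t + 1) * gapL n) (gapM n + (int r - 1 - int t) * gapL n)" for t
    by (simp add: g_def)
  have g_Suc: "g (Suc t) = min ((int t + 1) * gapL n + gapL n)
      (gapM n + (int r - 1 - int t) * gapL n - gapL n)" for t
    by (simp add: g_def algebra_simps)
  obtain F where lip: "\<And>u v. u \<in> W (Suc n) \<Longrightarrow> v \<in> W (Suc n) \<Longrightarrow> \<bar>F u - F v\<bar> \<le> dd (Suc n) u v"
    and F0: "\<And>u. F (u @ [q mod r]) = dd n u (corner n q)"
    and F: "\<And>u t. Suc t < r \<Longrightarrow> F (u @ [(q + Suc t) mod r]) =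
      min (dd n u (corner n (q + Suc t + f)) + g (Suc t)) (dd n u (corner n (q + Suc t + 2 * f)) + g t)"
  proof (rule ring_extension[OF n corners_gap[OF C], where q = q and \<Phi> = "\<lambda>u. dd n u (corner n q)" and g = g])
    show "\<bar>dd n x (corner n q) - dd n y (corner n q)\<bar> \<le> dd n x y" if "x \<in> W n" "y \<in> W n" for x y
      using dd_diff_le[OF n that corner_W] .
    have "dd n (corner n (q + f)) (corner n q) = gapL n" "dd n (corner n (q + 2 * f)) (corner n q) = gapM n"
      using corners_L[OF C, of q] corners_M[OF C, of q] dd_commute[OF n, of "corner n q"] by simp_all
    moreover have "g 0 = gapL n"
    proof -
      have "g 0 = min (gapL n) (gapM n + (int r * gapL n - gapL n))"
        by (simp add: g_def left_diff_distrib)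
      then show ?thesis using rL inv(1-3) by linarith
    qed
    moreover have "g (r - 1) = gapM n"
    proof -
      have "int (r - 1) = int r - 1" using r_ge_3 by simp
      then have "g (r - 1) = min (int r * gapL n) (gapM n)" by (simp add: g_def)
      then show ?thesis using rL inv(1-3) by linarith
    qed
    ultimately show "g 0 = dd n (corner n (q + f)) (corner n q)"
      "g (r - 1) = dd n (corner n (q + 2 * f)) (corner n q)" by simp_all
    show "\<bar>g (Suc t) - g t\<bar> \<le> gapL n" for t
      using inv(1) g[of t] g_Suc[of t] by linarith
  qed (rule that)
  have y: "F (corner (Suc n) q) = 0" by (simp add: corner_Suc F0)
  {
    assume t: "Suc t < r"
    have "F (corner (Suc n) (q + Suc t)) = min (gapL n + g (Suc t)) (gapM n + g t)"
      unfolding corner_Suc F[OF t] corners_L[OF C] corners_M[OF C] ..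
    then show "min (gapL n + g (Suc t)) (gapM n + g t)
      \<le> dd (Suc n) (corner (Suc n) (q + Suc t)) (corner (Suc n) q)"
      using lip[of "corner (Suc n) (q + Suc t)" "corner (Suc n) q"] y corner_W by simp
  }
  assume t: "t < r"
  have "F (glue n (q + t)) = g t"
  proof (cases t)
    case 0
    have "dd n (corner n (q + f)) (corner n q) = gapL n" using corners_L[OF C, of q] dd_commute[OF n, of "corner n q"] by simp
    then have "F (glue n q) = gapL n" by (simp add: glue_def F0)
    moreover have "g 0 = min (gapL n) (gapM n + (int r * gapL n - gapL n))"
      by (simp add: g_def left_diff_distrib)
    ultimately show ?thesis using 0 rL inv(1-3) by simp
  next
    case (Suc s)
    have "dd n (corner n (q + Suc s + f)) (corner n (q + Suc s + 2 * f)) = gapL n"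
      by (rule corners_gap[OF C])
    moreover have "g (Suc s) \<le> gapL n + g s" using inv(1) g[of s] g_Suc[of s] by linarith
    ultimately show ?thesis using F[of s] t Suc by (simp add: glue_def)
  qed
  then show "g t \<le> dd (Suc n) (glue n (q + t)) (corner (Suc n) q)"
    using lip[of "glue n (q + t)" "corner (Suc n) q"] y by simp
qed

lemma lip_cycle:
  fixes h :: "nat \<Rightarrow> int"
  assumes "\<And>i. i < r \<Longrightarrow> \<bar>h i - h ((i + 1) mod r)\<bar> \<le> 1" "a < r" "b < r"
  shows "\<bar>h a - h b\<bar> \<le> dd 1 [a] [b]"
proof -
  have "\<bar>h (hd u) - h (hd v)\<bar> \<le> 1" if "(u, v) \<in> word_edges r" "length u = 1" for u v
    using that
  proof (cases rule: word_edges.cases)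
    case (copy u' v' i)
    then show ?thesis using that(2) word_edges_words[OF copy(3)] by simp
  qed (use assms(1) in \<open>auto simp: abs_minus_commute\<close>)
  then have "\<bar>h (hd [a]) - h (hd [b])\<bar> \<le> dd 1 [a] [b]"
    using S_length_1 assms(2,3) by (intro lipI) (auto simp: W_iff)
  then show ?thesis by simp
qed

lemma cycle_walk: "dd 1 (corner 1 a) (corner 1 (a + k)) \<le> int k"
proof (induction k)
  case (Suc k)
  have "([(a + k) mod r], [((a + k) mod r + 1) mod r]) \<in> word_edges r"
    by (rule word_edges.cycle_succ) simp
  then have "([(a + k) mod r], [(a + Suc k) mod r]) \<in> word_edges r"
    by (simp add: mod_Suc_eq)
  then have "gdist (\<Gamma> 1) (V (corner 1 (a + k))) (V (corner 1 (a + Suc k))) \<le> 1"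
    by (intro gdist_edge edge_V) (simp_all add: corner_def)
  moreover have "dd 1 (corner 1 a) (corner 1 (a + Suc k))
      \<le> dd 1 (corner 1 a) (corner 1 (a + k)) + dd 1 (corner 1 (a + k)) (corner 1 (a + Suc k))"
    by (rule dd_triangle) auto
  ultimately show ?case using Suc by linarith
qed simp

lemma cycle_dist_lower:
  assumes "t < r"
  shows "min (int t) (int r - int t) \<le> dd 1 (corner 1 (a + t)) (corner 1 a)"
proof -
  define h where "h i = min (int (offset a i)) (int r - int (offset a i))" for i
  have "\<bar>h i - h ((i + 1) mod r)\<bar> \<le> 1" if "i < r" for i
  proof -
    obtain s where s: "s < r" "i = (a + s) mod r" using offset_cases[OF \<open>i < r\<close>] .
    have i': "(i + 1) mod r = (a + Suc s) mod r" using s(2) by (simp add: mod_Suc_eq)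
    have off: "offset a i = s" using s offset_add by simp
    show ?thesis
    proof (cases "Suc s < r")
      case True
      then have "offset a ((i + 1) mod r) = Suc s" unfolding i' by (rule offset_add)
      then show ?thesis unfolding h_def off by simp
    next
      case False
      then have r: "r = Suc s" using s(1) by simp
      then have "(a + Suc s) mod r = (a + 0) mod r" by (metis add_0_right mod_add_self2)
      then have "offset a ((i + 1) mod r) = 0" using i' offset_add[of 0 a] r_pos by simp
      then show ?thesis unfolding h_def off using r by simp
    qed
  qed
  then have "\<bar>h ((a + t) mod r) - h (a mod r)\<bar> \<le> dd 1 [(a + t) mod r] [a mod r]"
    by (intro lip_cycle) auto
  moreover have "offset a (a mod r) = 0" using offset_add[of 0 a] r_pos by simp
  moreover have "offset a ((a + t) mod r) = t" using offset_add[OF assms] .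
  ultimately show ?thesis by (simp add: corner_def h_def)
qed

text \<open>The way from \<open>a\<close> to \<open>a + f\<close> goes forward, the way from \<open>a\<close> to \<open>a + 2f\<close> goes backward, since
  \<open>r - 2f < 2f\<close>. Either way has one end piece of length \<open>gapL n\<close> and one of length \<open>gapM n\<close>; the copies in
  between, \<open>f - 1\<close> or \<open>r - 2f - 1\<close> of them, take \<open>gapL n\<close> steps each.\<close>

lemma corner_distances: "1 \<le> n \<Longrightarrow> corners_at n"
proof (induction n rule: nat_induct_at_least)
  case base
  show ?case
    unfolding corners_at_def
  proof (intro allI conjI antisym)
    fix a
    have L1: "gapL 1 = int f" "gapM 1 = int r - 2 * int f" by simp_all
    show "dd 1 (corner 1 a) (corner 1 (a + f)) \<le> gapL 1"
      unfolding L1 by (rule cycle_walk)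
    show "gapL 1 \<le> dd 1 (corner 1 a) (corner 1 (a + f))"
      unfolding L1 using cycle_dist_lower[of f a] f_bounds dd_commute[of 1] by simp
    have "corner 1 (a + 2 * f + (r - 2 * f)) = corner 1 a"
      using f_bounds by (intro corner_mod) simp
    then show "dd 1 (corner 1 a) (corner 1 (a + 2 * f)) \<le> gapM 1"
      unfolding L1 using cycle_walk[of "a + 2 * f" "r - 2 * f"] f_bounds dd_commute[of 1] by simp
    show "gapM 1 \<le> dd 1 (corner 1 a) (corner 1 (a + 2 * f))"
      unfolding L1 using cycle_dist_lower[of "2 * f" a] f_bounds dd_commute[of 1] by simp
  qed
next
  case (Suc n)
  note n = Suc.hyps and C = Suc.IH
  note inv = gap_inv[OF n]
  \<comment> \<open>with the products abbreviated, the remaining inequalities are linear\<close>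
  define P where "P = int f * gapL n"
  define Q where "Q = int r * gapL n"
  have Q: "2 * P \<le> Q" "Q \<le> 4 * P" "gapM n \<le> Q - 2 * P" "gapL n \<le> P"
  proof -
    have "2 * int f * gapL n \<le> int r * gapL n" "int r * gapL n \<le> 4 * int f * gapL n"
      "1 * gapL n \<le> int f * gapL n"
      using inv f_bounds by (intro mult_right_mono; simp)+
    then show "2 * P \<le> Q" "Q \<le> 4 * P" "gapL n \<le> P" by (simp_all add: P_def Q_def)
    show "gapM n \<le> Q - 2 * P" using inv(4) by (simp add: P_def Q_def left_diff_distrib)
  qed
  have LS: "gapL (Suc n) = P + gapM n" "gapM (Suc n) = Q - 2 * P + gapM n"
    by (simp_all add: P_def Q_def left_diff_distrib)
  have n': "1 \<le> Suc n" by simp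
  show ?case
    unfolding corners_at_def
  proof (intro allI conjI antisym)
    fix a
    \<comment> \<open>between the copies \<open>a\<close> and \<open>a + f\<close> there are \<open>k\<close> copies to cross\<close>
    define k where "k = f - 1"
    have k: "f = Suc k" using f_bounds(1) by (simp add: k_def)
    have kP: "int k * gapL n = P - gapL n" by (simp add: P_def k algebra_simps)
    have "dd (Suc n) (corner (Suc n) a) (corner (Suc n) (a + f))
        \<le> dd (Suc n) (corner (Suc n) a) (glue n a) + dd (Suc n) (glue n a) (corner (Suc n) (a + f))"
      by (rule dd_triangle) auto
    moreover have "dd (Suc n) (glue n a) (corner (Suc n) (a + f))
        \<le> dd (Suc n) (glue n a) (glue n (a + k)) + dd (Suc n) (glue n (a + k)) (corner (Suc n) (a + f))"
      by (rule dd_triangle) auto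
    moreover have "dd (Suc n) (glue n (a + k)) (corner (Suc n) (a + f)) \<le> gapM n"
      using glue_corner_left[OF n C, of "a + k"] by (simp add: k)
    ultimately show "dd (Suc n) (corner (Suc n) a) (corner (Suc n) (a + f)) \<le> gapL (Suc n)"
      using corner_glue_right[OF n C, of a] glue_steps[OF n C, of a k] kP unfolding LS by linarith
    show "gapL (Suc n) \<le> dd (Suc n) (corner (Suc n) a) (corner (Suc n) (a + f))"
    proof -
      have "Suc k < r" using f_bounds k by linarith
      from corner_glue_lower(2)[OF n C this, of a] show ?thesis
        unfolding LS dd_commute[OF n', of "corner (Suc n) a"] k[symmetric]
        using Q inv(1-3) kP by (simp add: algebra_simps k flip: P_def Q_def)
    qed
    \<comment> \<open>and between \<open>a + 2f\<close> and \<open>a + r\<close> there are \<open>m\<close>\<close>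
    define m where "m = r - 2 * f - 1"
    have m: "r = 2 * f + m + 1" using f_bounds by (simp add: m_def)
    have mP: "int m * gapL n = Q - 2 * P - gapL n"
    proof -
      have m_int: "int m = int r - 2 * int f - 1" using m by linarith
      show ?thesis unfolding m_int by (simp add: P_def Q_def left_diff_distrib)
    qed
    have "corner (Suc n) a = corner (Suc n) (a + 2 * f + m + 1)"
    proof (rule corner_mod)
      have sum: "a + 2 * f + m + 1 = a + r" using m by linarith
      show "a mod r = (a + 2 * f + m + 1) mod r" unfolding sum by simp
    qed
    then have "dd (Suc n) (glue n (a + 2 * f + m)) (corner (Suc n) a) \<le> gapM n"
      using glue_corner_left[OF n C, of "a + 2 * f + m"] by simp
    moreover have "dd (Suc n) (corner (Suc n) (a + 2 * f)) (corner (Suc n) a)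
        \<le> dd (Suc n) (corner (Suc n) (a + 2 * f)) (glue n (a + 2 * f))
          + dd (Suc n) (glue n (a + 2 * f)) (corner (Suc n) a)"
      by (rule dd_triangle) auto
    moreover have "dd (Suc n) (glue n (a + 2 * f)) (corner (Suc n) a)
        \<le> dd (Suc n) (glue n (a + 2 * f)) (glue n (a + 2 * f + m))
          + dd (Suc n) (glue n (a + 2 * f + m)) (corner (Suc n) a)"
      by (rule dd_triangle) auto
    ultimately show "dd (Suc n) (corner (Suc n) a) (corner (Suc n) (a + 2 * f)) \<le> gapM (Suc n)"
      using corner_glue_right[OF n C, of "a + 2 * f"] glue_steps[OF n C, of "a + 2 * f" m] mP
      unfolding LS dd_commute[OF n', of "corner (Suc n) a"] by linarith
    show "gapM (Suc n) \<le> dd (Suc n) (corner (Suc n) a) (corner (Suc n) (a + 2 * f))"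
    proof -
      define s where "s = 2 * f - 1"
      have s: "2 * f = Suc s" using f_bounds(1) by (simp add: s_def)
      have "Suc s < r" using f_bounds s by linarith
      have sP: "int s * gapL n = 2 * P - gapL n"
      proof -
        have "int s = 2 * int f - 1" using s by linarith
        then show ?thesis by (simp add: P_def left_diff_distrib)
      qed
      from corner_glue_lower(2)[OF n C \<open>Suc s < r\<close>, of a] show ?thesis
        unfolding LS dd_commute[OF n', of "corner (Suc n) a"] s
        using Q inv(1-3) sP by (simp add: algebra_simps flip: Q_def)
    qed
  qed
qed

section \<open>The labels of a shared vertex\<close>

lemma add_mod_neq:
  assumes "0 < k" "k < r"
  shows "(a + k) mod r \<noteq> a mod r"
proof
  assume "(a + k) mod r = a mod r"
  then have "r dvd k" by (metis add_diff_cancel_left' mod_eq_dvd_iff_nat le_add1)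
  then show False using assms by (auto dest: dvd_imp_le)
qed

definition corners_distinct :: "nat \<Rightarrow> bool" where
  "corners_distinct n \<longleftrightarrow> (\<forall>a b. (corner n a, corner n b) \<in> S \<longrightarrow> a mod r = b mod r)"

lemma corners_distinct_shift:
  assumes "corners_distinct n" "0 < k" "k < r"
  shows "(corner n (a + k), corner n a) \<notin> S" "(corner n a, corner n (a + k)) \<notin> S"
  using assms(1) add_mod_neq[OF assms(2,3), of a] unfolding corners_distinct_def by metis+

text \<open>A complete invariant of the vertex with label \<open>w\<close>: if the vertex is shared by the copies \<open>k\<close> and
  \<open>k + 1\<close>, it is the number \<open>k\<close>, and otherwise it is the copy together with the vertex of that copy.
  That it is invariant under \<open>same_vertex\<close> follows by induction over the rules, which is easier than
  describing the transitive closure directly.\<close>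

definition canonical_label :: "nat list \<Rightarrow> nat + nat list set \<times> nat" where
  "canonical_label w = (let u = butlast w; i = last w; n = length u in
     if (u, corner n (i + f)) \<in> S then Inl (i mod r)
     else if (u, corner n (i + 2 * f)) \<in> S then Inl ((i + (r - 1)) mod r)
     else Inr (V u, i))"

lemma canonical_label_snoc:
  "length u = n \<Longrightarrow> canonical_label (u @ [i]) =
     (if (u, corner n (i + f)) \<in> S then Inl (i mod r)
      else if (u, corner n (i + 2 * f)) \<in> S then Inl ((i + (r - 1)) mod r)
      else Inr (V u, i))"
  by (simp add: canonical_label_def Let_def)

lemma S_cong: "(u, v) \<in> S \<Longrightarrow> (u, w) \<in> S \<longleftrightarrow> (v, w) \<in> S"
  using V_eq[of u v] V_iff by blast

lemma canonical_label_eq: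
  assumes "(u, v) \<in> S" "length u = Suc n" "1 \<le> n" "corners_distinct n"
  shows "canonical_label u = canonical_label v"
  using assms(1,2)
proof (induction rule: same_vertex.induct)
  case (sym u v)
  then show ?case using S_words by fastforce
next
  case (trans u v w)
  then show ?case using S_words by fastforce
next
  case (copy u v i)
  have "length u = n" "length v = n" using copy S_words[OF copy(1)] by auto
  then show ?case using S_cong[OF copy(1)] V_eq[OF copy(1)] by (simp add: canonical_label_snoc)
next
  case (glue m i)
  then have m: "m = n" by simp
  let ?i = "(i + 1) mod r"
  have "canonical_label (corner n (i + f) @ [i]) = Inl (i mod r)"
    using same_vertex.refl corner_W[of n "i + f"] by (subst canonical_label_snoc[of _ n]) (auto simp: W_iff)
  moreover have "canonical_label (corner n (i + 1 + 2 * f) @ [?i]) = Inl ((?i + (r - 1)) mod r)"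
  proof -
    have "corner n (?i + f) = corner n (i + 1 + f)" "corner n (?i + 2 * f) = corner n (i + 1 + 2 * f)"
      by (rule corner_mod, rule mod_add_left_eq)+
    moreover have "(corner n (i + 1 + f + f), corner n (i + 1 + f)) \<notin> S"
      using f_bounds by (intro corners_distinct_shift[OF assms(4)]) auto
    moreover have "i + 1 + f + f = i + 1 + 2 * f" by simp
    moreover have "(corner n (i + 1 + 2 * f), corner n (i + 1 + 2 * f)) \<in> S"
      using same_vertex.refl corner_W[of n "i + 1 + 2 * f"] by (auto simp: W_iff)
    moreover have "length (corner n (i + 1 + 2 * f)) = n" by (simp add: corner_def)
    ultimately show ?thesis by (simp only: canonical_label_snoc if_False if_True)
  qed
  moreover have "(?i + (r - 1)) mod r = i mod r"
    using r_pos mod_add_left_eq[of "i + 1" r "r - 1"] by simp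
  ultimately show ?case unfolding m corner_def fshift2_def by simp
qed simp

text \<open>A corner of the next level is never one of the shared vertices, because \<open>a\<close>, \<open>a + f\<close> and \<open>a + 2f\<close> are
  distinct modulo \<open>r\<close>; so its invariant shows its last letter.\<close>

lemma corners_distinct_all: "1 \<le> n \<Longrightarrow> corners_distinct n"
proof (induction n rule: nat_induct_at_least)
  case base
  have "a mod r = b mod r" if "(corner 1 a, corner 1 b) \<in> S" for a b
    using S_length_1[OF that] by (simp add: corner_def)
  then show ?case by (simp add: corners_distinct_def)
next
  case (Suc n)
  have canonical_label: "canonical_label (corner (Suc n) a) = Inr (V (corner n a), a mod r)" for a
  proof -
    have "corner n (a mod r + f) = corner n (a + f)" "corner n (a mod r + 2 * f) = corner n (a + 2 * f)"
      by (rule corner_mod, rule mod_add_left_eq)+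
    moreover have "(corner n a, corner n (a + f)) \<notin> S" "(corner n a, corner n (a + 2 * f)) \<notin> S"
      using corners_distinct_shift(2)[OF Suc.IH, of f a] corners_distinct_shift(2)[OF Suc.IH, of "2 * f" a] f_bounds
      by auto
    moreover have "length (corner n a) = n" by (simp add: corner_def)
    ultimately show ?thesis unfolding corner_Suc by (simp only: canonical_label_snoc if_False)
  qed
  have "a mod r = b mod r" if "(corner (Suc n) a, corner (Suc n) b) \<in> S" for a b
  proof -
    have "length (corner (Suc n) a) = Suc n" by (simp add: corner_def)
    from canonical_label_eq[OF that this Suc.hyps Suc.IH] show ?thesis by (simp add: canonical_label)
  qed
  then show ?case by (simp add: corners_distinct_def)
qed

lemma shared_vertex_is_corner:
  assumes n: "1 \<le> n" and "(u @ [i], v @ [i']) \<in> S" "i \<noteq> i'"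
    and u: "u \<in> W n"
  shows "V u = V (corner n (i + f)) \<or> V u = V (corner n (i + 2 * f))"
proof (rule ccontr)
  assume "\<not> ?thesis"
  then have "(u, corner n (i + f)) \<notin> S" "(u, corner n (i + 2 * f)) \<notin> S" using V_eq by blast+
  moreover have len: "length u = n" "length v = n"
    using u S_words[OF assms(2)] by (auto simp: W_iff)
  ultimately have "canonical_label (u @ [i]) = Inr (V u, i)" by (simp add: canonical_label_snoc)
  moreover have "canonical_label (u @ [i]) = canonical_label (v @ [i'])"
    using assms(2) len n corners_distinct_all[OF n] by (intro canonical_label_eq) auto
  ultimately show False using assms(3) len by (simp add: canonical_label_snoc split: if_splits)
qed

lemma emb_verts: "x \<in> verts (\<Gamma> n) \<Longrightarrow> i < r \<Longrightarrow> emb i x \<in> verts (\<Gamma> (Suc n))"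
  by (auto simp: verts_\<Gamma> emb_V W_Suc)

lemma emb_isometric:
  assumes "1 \<le> n" "x \<in> verts (\<Gamma> n)" "y \<in> verts (\<Gamma> n)" "i < r"
  shows "gdist (\<Gamma> (Suc n)) (emb i x) (emb i y) = gdist (\<Gamma> n) x y"
proof -
  obtain u v where uv: "x = V u" "y = V v" "u \<in> W n" "v \<in> W n"
    using assms(2,3) by (auto simp: verts_\<Gamma>)
  have "dd (Suc n) (u @ [i]) (v @ [i]) = dd n u v"
    using assms(1,4) uv corners_gap[OF corner_distances] by (intro copy_isometric) auto
  then show ?thesis using uv assms(4) by (simp add: emb_V)
qed

end

section \<open>The tower of copies with one fixed letter\<close>

text \<open>The letter \<open>j\<close> is the one that is repeated in \<open>wj\<^sup>\<infinity>\<close>.\<close>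

locale sierpinski_tower = sierpinski +
  fixes j :: nat
  assumes j_less: "j < r"
begin

definition gateA :: "nat \<Rightarrow> nat list set" where "gateA n = V (corner n (j + f))"
definition gateB :: "nat \<Rightarrow> nat list set" where "gateB n = V (corner n (j + 2 * f))"

lemma gateA_verts [simp]: "gateA n \<in> verts (\<Gamma> n)" and gateB_verts [simp]: "gateB n \<in> verts (\<Gamma> n)"
  by (simp_all add: gateA_def gateB_def)

abbreviation e :: "nat list set \<Rightarrow> nat list set" where "e \<equiv> emb j"

lemma e_gateA: "e (gateA n) = V (glue n j)"
  unfolding gateA_def glue_def emb_V[OF corner_W j_less] using j_less by simp

lemma e_gateB: "1 \<le> n \<Longrightarrow> e (gateB n) = V (glue n (j + r - 1))"
proof -
  assume "1 \<le> n"
  have eq: "j + r - 1 + 1 = j + r" using r_pos by simp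
  have "corner n (j + r + 2 * f) = corner n (j + 2 * f)"
    by (rule corner_mod) (metis add.assoc add.commute mod_add_self2)
  then show ?thesis
    using V_glue[OF \<open>1 \<le> n\<close>, of "j + r - 1"] j_less
    unfolding eq gateB_def emb_V[OF corner_W j_less] by simp
qed

text \<open>An edge is contained in a copy. If it leaves the copy \<open>j\<close>, it lies in another copy, so its first vertex
  is shared by two copies.\<close>

lemma edge_out:
  assumes n: "1 \<le> n" and xy: "(x, y) \<in> edges (\<Gamma> (Suc n))"
    and x: "x \<in> e ` verts (\<Gamma> n)" and y: "y \<notin> e ` verts (\<Gamma> n)"
  shows "x = e (gateA n) \<or> x = e (gateB n)"
proof -
  obtain u' v' where uv': "x = V u'" "y = V v'" "(u', v') \<in> word_edges r" "length u' = Suc n"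
    using xy by (auto simp: edges_\<Gamma>)
  from uv'(3) obtain u v i where uv: "u' = u @ [i]" "v' = v @ [i]" "(u, v) \<in> word_edges r" "i < r"
  proof (cases rule: word_edges.cases)
    case (copy a b k)
    then show ?thesis using that by blast
  qed (use n uv'(4) in auto)
  have W: "u \<in> W n" "v \<in> W n" using word_edges_words[OF uv(3)] uv'(4) uv(1) by (auto simp: W_iff)
  have "i \<noteq> j"
  proof
    assume "i = j"
    then have "y = e (V v)" using uv uv' W j_less by (simp add: emb_V)
    then show False using y W by (auto simp: verts_\<Gamma>)
  qed
  obtain z where z: "x = V (z @ [j])" "z \<in> W n"
    using x j_less by (auto simp: verts_\<Gamma> emb_V)
  have "(z @ [j], u @ [i]) \<in> S"
    using z uv uv' W V_eq_iff[of "u @ [i]" "Suc n" "z @ [j]"] by (simp add: W_Suc)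
  then have "V z = V (corner n (j + f)) \<or> V z = V (corner n (j + 2 * f))"
    using \<open>i \<noteq> j\<close> z(2) n by (intro shared_vertex_is_corner) auto
  moreover have "x = e (V z)" using z j_less by (simp add: emb_V)
  ultimately show ?thesis by (auto simp: gateA_def gateB_def)
qed

lemma corner_outside:
  assumes n: "1 \<le> n" and c: "c mod r \<noteq> j"
  shows "V (corner (Suc n) c) \<notin> e ` verts (\<Gamma> n)"
proof
  assume "V (corner (Suc n) c) \<in> e ` verts (\<Gamma> n)"
  then obtain z where z: "V (corner n c @ [c mod r]) = V (z @ [j])" "z \<in> W n"
    using j_less by (auto simp: verts_\<Gamma> emb_V corner_Suc)
  then have "(corner n c @ [c mod r], z @ [j]) \<in> S"
    using V_eq_iff[of "z @ [j]" "Suc n"] j_less by (simp add: W_Suc)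
  then have "V (corner n c) = V (corner n (c mod r + f)) \<or> V (corner n c) = V (corner n (c mod r + 2 * f))"
    using c n by (intro shared_vertex_is_corner) auto
  moreover have "corner n (c mod r + f) = corner n (c + f)" "corner n (c mod r + 2 * f) = corner n (c + 2 * f)"
    by (rule corner_mod, rule mod_add_left_eq)+
  ultimately have "(corner n c, corner n (c + f)) \<in> S \<or> (corner n c, corner n (c + 2 * f)) \<in> S"
    using V_eq_iff[OF corner_W] by simp
  then show False
    using corners_distinct_shift(2)[OF corners_distinct_all[OF n], of f c]
      corners_distinct_shift(2)[OF corners_distinct_all[OF n], of "2 * f" c] f_bounds by auto
qed

lemma gate_letters: "(j + f) mod r \<noteq> j" "(j + 2 * f) mod r \<noteq> j"
  using add_mod_neq[of f j] add_mod_neq[of "2 * f" j] f_bounds j_less by auto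

lemma gateA_outside: "1 \<le> n \<Longrightarrow> gateA (Suc n) \<notin> e ` verts (\<Gamma> n)"
  and gateB_outside: "1 \<le> n \<Longrightarrow> gateB (Suc n) \<notin> e ` verts (\<Gamma> n)"
  unfolding gateA_def gateB_def by (intro corner_outside gate_letters; assumption)+

lemma gap_tower: "1 \<le> n \<Longrightarrow> int (gdist (\<Gamma> n) (gateA n) (gateB n)) = gapL n"
  using corners_gap[OF corner_distances] by (simp add: gateA_def gateB_def)

lemma gap_increasing:
  assumes "1 \<le> n"
  shows "gdist (\<Gamma> n) (gateA n) (gateB n) < gdist (\<Gamma> (Suc n)) (gateA (Suc n)) (gateB (Suc n))"
proof -
  have "1 * gapL n \<le> int f * gapL n"
    using gap_inv[OF assms] f_bounds by (intro mult_right_mono) auto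
  then have "gapL n < gapL (Suc n)" using gap_inv(2)[OF assms] by simp
  then show ?thesis using gap_tower[OF assms] gap_tower[of "Suc n"] by simp
qed

text \<open>From \<open>e (gateB n)\<close>, the way to \<open>gateA (Suc n)\<close> through the copies \<open>j, j + 1, \<dots>, j + f\<close> is not
  longer than the opposite one by \<open>gapM n \<le> (r - 2f) gapL n\<close>, and it passes through \<open>e (gateA n)\<close>.\<close>

lemma BA_tower:
  assumes n: "1 \<le> n"
  shows "gdist (\<Gamma> (Suc n)) (e (gateB n)) (gateA (Suc n))
    = gdist (\<Gamma> (Suc n)) (e (gateB n)) (e (gateA n)) + gdist (\<Gamma> (Suc n)) (e (gateA n)) (gateA (Suc n))"
proof (rule antisym)
  show "gdist (\<Gamma> (Suc n)) (e (gateB n)) (gateA (Suc n))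
    \<le> gdist (\<Gamma> (Suc n)) (e (gateB n)) (e (gateA n)) + gdist (\<Gamma> (Suc n)) (e (gateA n)) (gateA (Suc n))"
    using j_less by (intro gdist_triangle walk_connected_\<Gamma> emb_verts) auto
  note C = corner_distances[OF n] and inv = gap_inv[OF n]
  have 1: "int (gdist (\<Gamma> (Suc n)) (e (gateB n)) (e (gateA n))) = gapL n"
    using emb_isometric[OF n _ _ j_less, of "gateB n" "gateA n"] gap_tower[OF n]
      gdist_commute[OF walk_connected_\<Gamma>[OF n], of "gateA n" "gateB n"] by simp
  define k where "k = f - 1"
  have k: "f = Suc k" using f_bounds(1) by (simp add: k_def)
  have "dd (Suc n) (glue n j) (corner (Suc n) (j + f))
      \<le> dd (Suc n) (glue n j) (glue n (j + k)) + dd (Suc n) (glue n (j + k)) (corner (Suc n) (j + f))"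
    by (rule dd_triangle) auto
  moreover have "dd (Suc n) (glue n (j + k)) (corner (Suc n) (j + f)) \<le> gapM n"
    using glue_corner_left[OF n C, of "j + k"] by (simp add: k)
  moreover have "int k * gapL n = int f * gapL n - gapL n"
    by (simp add: k distrib_right)
  ultimately have 2: "dd (Suc n) (glue n j) (corner (Suc n) (j + f)) \<le> int f * gapL n - gapL n + gapM n"
    using glue_steps[OF n C, of j k] by linarith
  \<comment> \<open>counted from \<open>q = j + f\<close>, the gate \<open>B\<close> is shared by the copies \<open>q + t\<close> and \<open>q + t + 1\<close>\<close>
  define t where "t = r - f - 1"
  have t: "t < r" "j + f + t = j + r - 1" "int t = int r - int f - 1"
    using f_bounds by (auto simp: t_def)
  have "(int t + 1) * gapL n = int r * gapL n - int f * gapL n"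
    "gapM n + (int r - 1 - int t) * gapL n = gapM n + int f * gapL n"
    by (simp_all add: t(3) left_diff_distrib)
  moreover have "gapM n \<le> int r * gapL n - 2 * (int f * gapL n)"
    using inv(4) by (simp add: left_diff_distrib)
  ultimately have 3: "int f * gapL n + gapM n \<le> dd (Suc n) (glue n (j + r - 1)) (corner (Suc n) (j + f))"
    using corner_glue_lower(1)[OF n C t(1), of "j + f"] unfolding t(2) by linarith
  show "gdist (\<Gamma> (Suc n)) (e (gateB n)) (e (gateA n)) + gdist (\<Gamma> (Suc n)) (e (gateA n)) (gateA (Suc n))
    \<le> gdist (\<Gamma> (Suc n)) (e (gateB n)) (gateA (Suc n))"
    using 1 2 3 unfolding e_gateA e_gateB[OF n] gateA_def[of "Suc n"] by linarith
qed

text \<open>Here the two ways have lengths \<open>(r - 2f + 1) gapL n\<close>, through \<open>e (gateB n)\<close>, and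
  \<open>(2f - 1) gapL n + gapM n\<close>.\<close>

lemma AB_tower:
  assumes n: "1 \<le> n"
  shows "gdist (\<Gamma> (Suc n)) (e (gateA n)) (gateB (Suc n))
    = gdist (\<Gamma> (Suc n)) (e (gateA n)) (e (gateB n)) + gdist (\<Gamma> (Suc n)) (e (gateB n)) (gateB (Suc n))"
proof (rule antisym)
  show "gdist (\<Gamma> (Suc n)) (e (gateA n)) (gateB (Suc n))
    \<le> gdist (\<Gamma> (Suc n)) (e (gateA n)) (e (gateB n)) + gdist (\<Gamma> (Suc n)) (e (gateB n)) (gateB (Suc n))"
    using j_less by (intro gdist_triangle walk_connected_\<Gamma> emb_verts) auto
  note C = corner_distances[OF n] and inv = gap_inv[OF n]
  have n': "1 \<le> Suc n" by simp
  have 1: "int (gdist (\<Gamma> (Suc n)) (e (gateA n)) (e (gateB n))) = gapL n"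
    using emb_isometric[OF n _ _ j_less, of "gateA n" "gateB n"] gap_tower[OF n] by simp
  define m where "m = r - 2 * f - 1"
  have m: "j + 2 * f + m = j + r - 1" "int m = int r - 2 * int f - 1" using f_bounds by (auto simp: m_def)
  have "dd (Suc n) (corner (Suc n) (j + 2 * f)) (glue n (j + r - 1))
      \<le> dd (Suc n) (corner (Suc n) (j + 2 * f)) (glue n (j + 2 * f))
        + dd (Suc n) (glue n (j + 2 * f)) (glue n (j + r - 1))"
    by (rule dd_triangle) auto
  moreover have "int m * gapL n = int r * gapL n - 2 * (int f * gapL n) - gapL n"
    by (simp add: m(2) left_diff_distrib)
  ultimately have 2: "dd (Suc n) (glue n (j + r - 1)) (corner (Suc n) (j + 2 * f))
      \<le> int r * gapL n - 2 * (int f * gapL n)"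
    using glue_steps[OF n C, of "j + 2 * f" m] corner_glue_right[OF n C, of "j + 2 * f"]
      dd_commute[OF n', of "glue n (j + r - 1)"] unfolding m(1) by simp
  \<comment> \<open>counted from \<open>q = j + 2f\<close>, the gate \<open>A\<close> is shared by the copies \<open>q + t\<close> and \<open>q + t + 1\<close>\<close>
  define t where "t = r - 2 * f"
  have t: "t < r" "j + 2 * f + t = j + r" "int t = int r - 2 * int f"
    using f_bounds by (auto simp: t_def)
  have eqs: "(int t + 1) * gapL n = int r * gapL n - 2 * (int f * gapL n) + gapL n"
    "gapM n + (int r - 1 - int t) * gapL n = gapM n + 2 * (int f * gapL n) - gapL n"
    by (simp_all add: t(3) left_diff_distrib distrib_right)
  have "min (int r * gapL n - 2 * (int f * gapL n) + gapL n) (gapM n + 2 * (int f * gapL n) - gapL n)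
      \<le> dd (Suc n) (glue n j) (corner (Suc n) (j + 2 * f))"
    using corner_glue_lower(1)[OF n C t(1), of "j + 2 * f"]
    unfolding t(2) eqs glue_mod[OF mod_add_self2] .
  moreover have "int r * gapL n + 2 * gapL n - 4 * (int f * gapL n) \<le> gapM n"
    using inv(5) by (simp add: left_diff_distrib distrib_right)
  ultimately have 3: "int r * gapL n - 2 * (int f * gapL n) + gapL n
      \<le> dd (Suc n) (glue n j) (corner (Suc n) (j + 2 * f))"
    by linarith
  show "gdist (\<Gamma> (Suc n)) (e (gateA n)) (e (gateB n)) + gdist (\<Gamma> (Suc n)) (e (gateB n)) (gateB (Suc n))
    \<le> gdist (\<Gamma> (Suc n)) (e (gateA n)) (gateB (Suc n))"
    using 1 2 3 unfolding e_gateA e_gateB[OF n] gateB_def[of "Suc n"] by linarith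
qed

text \<open>The walk runs through the copies \<open>j + 1, \<dots>, j + r - 1\<close>. Inside of these it may use any vertex,
  as a vertex that also belongs to the copy \<open>j\<close> is one of the gates.\<close>

lemma detour_tower:
  assumes n: "1 \<le> n"
  shows "(e (gateA n), e (gateB n)) \<in> (Restr (edges (\<Gamma> (Suc n)))
    (verts (\<Gamma> (Suc n)) - e ` verts (\<Gamma> n) \<union> {e (gateA n), e (gateB n)}))\<^sup>*"
proof -
  define U where "U = verts (\<Gamma> (Suc n)) - e ` verts (\<Gamma> n) \<union> {e (gateA n), e (gateB n)}"
  let ?R = "Restr (edges (\<Gamma> (Suc n))) U"
  have in_U: "V (u @ [i]) \<in> U" if u: "u \<in> W n" and i: "i < r" "i \<noteq> j" for u i
  proof (cases "V (u @ [i]) \<in> e ` verts (\<Gamma> n)")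
    case True
    then obtain z where z: "V (u @ [i]) = V (z @ [j])" "z \<in> W n"
      using j_less by (auto simp: verts_\<Gamma> emb_V)
    then have "(z @ [j], u @ [i]) \<in> S"
      using V_eq_iff[of "u @ [i]" "Suc n" "z @ [j]"] u i by (simp add: W_Suc)
    then have "V z = V (corner n (j + f)) \<or> V z = V (corner n (j + 2 * f))"
      using i z(2) n by (intro shared_vertex_is_corner) auto
    moreover have "V (u @ [i]) = e (V z)" using z j_less by (simp add: emb_V)
    ultimately show ?thesis by (auto simp: gateA_def gateB_def U_def)
  next
    case False
    then show ?thesis using u i by (simp add: U_def W_Suc)
  qed
  have copy: "(V (u @ [i]), V (v @ [i])) \<in> ?R\<^sup>*" if "u \<in> W n" "v \<in> W n" "i < r" "i \<noteq> j" for u v i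
  proof -
    have "(V u, V v) \<in> (edges (\<Gamma> n))\<^sup>*"
      using walk_connected_\<Gamma>[OF n] that by (auto simp: walk_connected_def)
    then have "(emb i (V u), emb i (V v)) \<in> ?R\<^sup>*"
    proof (rule rtrancl_homomorphic)
      fix x y assume xy: "(x, y) \<in> edges (\<Gamma> n)"
      then have "x \<in> verts (\<Gamma> n)" "y \<in> verts (\<Gamma> n)" using edges_\<Gamma>_verts by auto
      then have "emb i x \<in> U" "emb i y \<in> U" using in_U that by (auto simp: verts_\<Gamma> emb_V)
      then show "(emb i x, emb i y) \<in> ?R" using edges_emb[OF xy \<open>i < r\<close>] by blast
    qed
    then show ?thesis using that by (simp add: emb_V)
  qed
  have "(V (glue n j), V (glue n (j + t))) \<in> ?R\<^sup>*" if "t < r" for t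
    using that
  proof (induction t)
    case (Suc t)
    have "(j + t + 1) mod r \<noteq> j" using add_mod_neq[of "Suc t" j] Suc.prems j_less by simp
    then have "(V (corner n (j + t + 1 + 2 * f) @ [(j + t + 1) mod r]),
        V (corner n (j + t + 1 + f) @ [(j + t + 1) mod r])) \<in> ?R\<^sup>*"
      by (intro copy) auto
    then have "(V (glue n (j + t)), V (glue n (j + Suc t))) \<in> ?R\<^sup>*"
      using V_glue[OF n, of "j + t"] by (simp add: glue_def)
    with Suc show ?case by (meson Suc_lessD rtrancl_trans)
  qed simp
  from this[of "r - 1"] have "(V (glue n j), V (glue n (j + r - 1))) \<in> ?R\<^sup>*"
    using r_pos by simp
  then show ?thesis by (simp add: e_gateA e_gateB[OF n] U_def)
qed

lemma gdist_through_tower_gate: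
  assumes n: "1 \<le> n" and "x \<in> verts (\<Gamma> n)" "v \<in> verts (\<Gamma> (Suc n)) - e ` verts (\<Gamma> n)"
  shows "gdist (\<Gamma> (Suc n)) (e x) v =
    min (gdist (\<Gamma> (Suc n)) (e x) (e (gateA n)) + gdist (\<Gamma> (Suc n)) (e (gateA n)) v)
        (gdist (\<Gamma> (Suc n)) (e x) (e (gateB n)) + gdist (\<Gamma> (Suc n)) (e (gateB n)) v)"
proof (rule gdist_through_gate[of _ "e ` verts (\<Gamma> n)"])
  show "walk_connected (\<Gamma> (Suc n))" by (simp add: walk_connected_\<Gamma>)
  show "e ` verts (\<Gamma> n) \<subseteq> verts (\<Gamma> (Suc n))" using emb_verts j_less by blast
  show "x' = e (gateA n) \<or> x' = e (gateB n)"
    if "(x', y') \<in> edges (\<Gamma> (Suc n))" "x' \<in> e ` verts (\<Gamma> n)" "y' \<notin> e ` verts (\<Gamma> n)" for x' y'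
    using edge_out[OF n that] .
qed (use assms in auto)

text \<open>A vertex outside of the copy is at least one step beyond a gate. In particular this holds for the
  gates of the next level, so the distance from the base point to the gates grows.\<close>

lemma escape:
  assumes n0: "1 \<le> n0" and p: "\<And>n. n0 \<le> n \<Longrightarrow> p n \<in> verts (\<Gamma> n)"
    and p_Suc: "\<And>n. n0 \<le> n \<Longrightarrow> p (Suc n) = e (p n)" and "n0 \<le> n"
  shows "v \<in> verts (\<Gamma> (Suc n)) - e ` verts (\<Gamma> n) \<Longrightarrow> n - n0 < gdist (\<Gamma> (Suc n)) (p (Suc n)) v"
proof -
  have step: "m < gdist (\<Gamma> (Suc n)) (p (Suc n)) v"
    if n: "n0 \<le> n" and g: "m \<le> gdist (\<Gamma> n) (p n) (gateA n)" "m \<le> gdist (\<Gamma> n) (p n) (gateB n)"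
      and v: "v \<in> verts (\<Gamma> (Suc n)) - e ` verts (\<Gamma> n)" for n m v
  proof -
    have n1: "1 \<le> n" using n n0 by simp
    have iso: "gdist (\<Gamma> (Suc n)) (e (p n)) (e x) = gdist (\<Gamma> n) (p n) x" if "x \<in> verts (\<Gamma> n)" for x
      using emb_isometric[OF n1 p[OF n] that j_less] .
    have "gdist (\<Gamma> (Suc n)) (e x) v \<noteq> 0" if "x \<in> verts (\<Gamma> n)" for x
      using gdist_eq_0[OF walk_connected_\<Gamma>, of "Suc n" "e x" v] v that emb_verts[OF that j_less] by auto
    then have "0 < gdist (\<Gamma> (Suc n)) (e (gateA n)) v" "0 < gdist (\<Gamma> (Suc n)) (e (gateB n)) v"
      by simp_all
    then show ?thesis
      using gdist_through_tower_gate[OF n1 p[OF n] v] g iso[OF gateA_verts] iso[OF gateB_verts]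
      unfolding p_Suc[OF n] by linarith
  qed
  have gates: "n - n0 \<le> gdist (\<Gamma> n) (p n) (gateA n) \<and> n - n0 \<le> gdist (\<Gamma> n) (p n) (gateB n)"
    using \<open>n0 \<le> n\<close>
  proof (induction n rule: nat_induct_at_least)
    case (Suc n)
    have "1 \<le> n" using Suc.hyps n0 by simp
    have "n - n0 < gdist (\<Gamma> (Suc n)) (p (Suc n)) (gateA (Suc n))"
      using Suc gateA_outside[OF \<open>1 \<le> n\<close>] by (intro step) auto
    moreover have "n - n0 < gdist (\<Gamma> (Suc n)) (p (Suc n)) (gateB (Suc n))"
      using Suc gateB_outside[OF \<open>1 \<le> n\<close>] by (intro step) auto
    ultimately show ?case by linarith
  qed simp
  show "v \<in> verts (\<Gamma> (Suc n)) - e ` verts (\<Gamma> n) \<Longrightarrow> n - n0 < gdist (\<Gamma> (Suc n)) (p (Suc n)) v"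
    using gates \<open>n0 \<le> n\<close> by (intro step) auto
qed

section \<open>Two gates in the limit graph\<close>

lemma finite_verts_\<Gamma>: "finite (verts (\<Gamma> n))"
proof -
  have "W n = {u. set u \<subseteq> {..<r} \<and> length u = n}" by (auto simp: W_iff)
  then show ?thesis unfolding verts_\<Gamma> using finite_lists_length_eq[of "{..<r}" n] by simp
qed

text \<open>An edge of \<open>X\<close> is visible in the finite graphs as a pair of vertices at distance 1. If it leaves the
  \<open>n\<close>-th image and the first image containing its other end has the number \<open>Suc k\<close>, then it starts at a
  gate of the \<open>k\<close>-th image; this gate is new in that image, so \<open>k = n\<close>.\<close>

lemma two_gates_union:
  fixes X :: "'v graph"
  assumes X: "walk_connected X" and n0: "1 \<le> n0"
    and \<psi>: "\<And>n x. x \<in> verts (\<Gamma> (n0 + n)) \<Longrightarrow> \<psi> n x \<in> verts X"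
    and iso: "\<And>n x y. x \<in> verts (\<Gamma> (n0 + n)) \<Longrightarrow> y \<in> verts (\<Gamma> (n0 + n)) \<Longrightarrow>
      gdist X (\<psi> n x) (\<psi> n y) = gdist (\<Gamma> (n0 + n)) x y"
    and coh: "\<And>n x. x \<in> verts (\<Gamma> (n0 + n)) \<Longrightarrow> \<psi> (Suc n) (e x) = \<psi> n x"
    and union: "(\<Union>n. \<psi> n ` verts (\<Gamma> (n0 + n))) = verts X"
  shows "two_gates X (\<lambda>n. \<psi> n ` verts (\<Gamma> (n0 + n))) (\<lambda>n. \<psi> n (gateA (n0 + n))) (\<lambda>n. \<psi> n (gateB (n0 + n)))"
proof -
  define G where "G n = \<psi> n ` verts (\<Gamma> (n0 + n))" for n
  define A where "A n = \<psi> n (gateA (n0 + n))" for n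
  define B where "B n = \<psi> n (gateB (n0 + n))" for n
  have pos: "1 \<le> n0 + n" for n using n0 by simp
  have inj: "x = y" if "\<psi> n x = \<psi> n y" "x \<in> verts (\<Gamma> (n0 + n))" "y \<in> verts (\<Gamma> (n0 + n))" for n x y
    using iso[OF that(2,3)] that gdist_eq_0[OF walk_connected_\<Gamma>[OF pos] that(2,3)] by simp
  have e_in: "e x \<in> verts (\<Gamma> (n0 + Suc n))" if "x \<in> verts (\<Gamma> (n0 + n))" for n x
    using emb_verts[OF that j_less] by simp
  have outside: "\<psi> (Suc n) y \<notin> G n"
    if y: "y \<in> verts (\<Gamma> (n0 + Suc n))" "y \<notin> e ` verts (\<Gamma> (n0 + n))" for n y
  proof
    assume "\<psi> (Suc n) y \<in> G n"
    then obtain x where x: "\<psi> (Suc n) y = \<psi> (Suc n) (e x)" "x \<in> verts (\<Gamma> (n0 + n))"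
      using coh by (auto simp: G_def)
    then have "y = e x" using inj[OF x(1) y(1) e_in] by blast
    then show False using y x by blast
  qed
  have A_Suc: "A n = \<psi> (Suc n) (e (gateA (n0 + n)))" and B_Suc: "B n = \<psi> (Suc n) (e (gateB (n0 + n)))" for n
    by (simp_all add: A_def B_def coh)
  have A_new: "A (Suc n) \<notin> G n" and B_new: "B (Suc n) \<notin> G n" for n
    unfolding A_def B_def
    using outside[OF gateA_verts, of n] outside[OF gateB_verts, of n] gateA_outside[OF pos, of n] gateB_outside[OF pos, of n]
    by simp_all
  have mono: "G n \<subseteq> G (Suc n)" for n
    using e_in coh unfolding G_def by (metis image_subsetI rev_image_eqI)
  then have G_mono: "G m \<subseteq> G n" if "m \<le> n" for m n
    using that by (rule lift_Suc_mono_le)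
  have "two_gates X G A B"
  proof unfold_locales
    fix n
    show "finite (G n)" by (simp add: G_def finite_verts_\<Gamma>)
    show "A n \<in> G n" "B n \<in> G n" by (simp_all add: A_def B_def G_def)
    show "gdist X (A n) (B (Suc n)) = gdist X (A n) (B n) + gdist X (B n) (B (Suc n))"
      unfolding A_Suc B_Suc[of n] B_def[of "Suc n"]
      using AB_tower[OF pos, of n] e_in by (simp add: iso)
    show "gdist X (B n) (A (Suc n)) = gdist X (B n) (A n) + gdist X (A n) (A (Suc n))"
      unfolding A_Suc[of n] B_Suc A_def[of "Suc n"]
      using BA_tower[OF pos, of n] e_in by (simp add: iso)
    show "gdist X (A n) (B n) < gdist X (A (Suc n)) (B (Suc n))"
      unfolding A_def B_def using gap_increasing[OF pos, of n] by (simp add: iso)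
    let ?U = "verts (\<Gamma> (n0 + Suc n)) - e ` verts (\<Gamma> (n0 + n)) \<union> {e (gateA (n0 + n)), e (gateB (n0 + n))}"
    let ?R = "Restr (edges X) (verts X - G n \<union> {A n, B n})"
    have "(e (gateA (n0 + n)), e (gateB (n0 + n))) \<in> (Restr (edges (\<Gamma> (n0 + Suc n))) ?U)\<^sup>*"
      using detour_tower[OF pos, of n] by simp
    then have "(\<psi> (Suc n) (e (gateA (n0 + n))), \<psi> (Suc n) (e (gateB (n0 + n)))) \<in> ?R\<^sup>*"
    proof (induction rule: rtrancl_induct)
      case (step x y)
      then have xy: "(x, y) \<in> edges (\<Gamma> (n0 + Suc n))" "x \<in> ?U" "y \<in> ?U" by auto
      then have V: "x \<in> verts (\<Gamma> (n0 + Suc n))" "y \<in> verts (\<Gamma> (n0 + Suc n))"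
        using edges_\<Gamma>_verts by blast+
      have in_U: "\<psi> (Suc n) z \<in> verts X - G n \<union> {A n, B n}" if "z \<in> ?U" for z
        using that outside \<psi> A_Suc B_Suc by auto
      have "gdist X (\<psi> (Suc n) x) (\<psi> (Suc n) y) \<le> 1"
        using iso[OF V] gdist_edge[OF xy(1)] by simp
      then have "\<psi> (Suc n) x = \<psi> (Suc n) y \<or> (\<psi> (Suc n) x, \<psi> (Suc n) y) \<in> edges X"
        using gdist_eq_0[OF X \<psi>[OF V(1)] \<psi>[OF V(2)]] edge_if_gdist_1[OF X \<psi>[OF V(1)] \<psi>[OF V(2)]]
        by linarith
      then have "(\<psi> (Suc n) x, \<psi> (Suc n) y) \<in> ?R\<^sup>*" using in_U[OF xy(2)] in_U[OF xy(3)] by auto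
      with step.IH show ?case by (rule rtrancl_trans)
    qed simp
    then show "(A n, B n) \<in> ?R\<^sup>*" unfolding A_Suc B_Suc .
    fix x y assume xy: "(x, y) \<in> edges X" "x \<in> G n" "y \<notin> G n"
    have V: "x \<in> verts X" "y \<in> verts X" using xy(1) X by (auto simp: walk_connected_def)
    have "\<exists>m. y \<in> G m" using V(2) union unfolding G_def by blast
    define i where "i = (LEAST m. y \<in> G m)"
    have i: "y \<in> G i" unfolding i_def using \<open>\<exists>m. y \<in> G m\<close> by (rule LeastI_ex)
    have "n < i" using i xy(3) G_mono[of i n] by (meson not_le subsetD)
    then obtain k where k: "i = Suc k" "n \<le> k" by (cases i) auto
    have "y \<notin> G k" using not_less_Least[of k "\<lambda>m. y \<in> G m"] k(1) by (simp add: i_def)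
    obtain v where v: "y = \<psi> (Suc k) v" "v \<in> verts (\<Gamma> (n0 + Suc k))" using i k(1) by (auto simp: G_def)
    have "x \<in> G k" using xy(2) G_mono[OF k(2)] by blast
    then obtain u where u: "x = \<psi> (Suc k) (e u)" "u \<in> verts (\<Gamma> (n0 + k))" using coh by (auto simp: G_def)
    have v_out: "v \<notin> e ` verts (\<Gamma> (n0 + k))" using \<open>y \<notin> G k\<close> v(1) coh by (auto simp: G_def)
    have "x \<noteq> y" using xy by blast
    then have "gdist X x y = 1"
      using gdist_edge[OF xy(1)] gdist_eq_0[OF X V] by linarith
    then have "gdist (\<Gamma> (n0 + Suc k)) (e u) v = 1" using iso[OF e_in[OF u(2)] v(2)] u v by simp
    then have "(e u, v) \<in> edges (\<Gamma> (n0 + Suc k))"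
      using e_in[OF u(2)] v(2) pos by (intro edge_if_gdist_1 walk_connected_\<Gamma>) auto
    then have "e u = e (gateA (n0 + k)) \<or> e u = e (gateB (n0 + k))"
      using u(2) v_out edge_out[OF pos, of "e u" v k] by simp
    then have x_gate: "x = A k \<or> x = B k" using u(1) A_Suc B_Suc by auto
    have "k = n"
    proof (rule ccontr)
      assume "k \<noteq> n"
      then obtain l where "k = Suc l" "n \<le> l" using k(2) by (cases k) auto
      then show False using x_gate A_new[of l] B_new[of l] xy(2) G_mono[of n l] by auto
    qed
    then show "x = A n \<or> x = B n" using x_gate by simp
  qed (use X union mono A_new B_new in \<open>auto simp: G_def\<close>)
  then show ?thesis unfolding G_def A_def B_def .
qed

end

section \<open>Busemann and non-Busemann points\<close>

theorem theorem3p15: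
  fixes r j :: nat and w :: "nat list"
    and X :: "'v graph" and p x0 :: 'v
  assumes "r \<ge> 3" and "\<not> 4 dvd r"
    and "set w \<subseteq> {..<r}" and "j < r"
    and "is_sierp_limit r (w @- sconst j) X p"
    and "x0 \<in> verts X"
  shows "card (busemann_points X x0) = 2 \<and>
         countable (non_busemann_points X x0) \<and> infinite (non_busemann_points X x0)"
proof -
  interpret sierpinski_tower r j by unfold_locales (use assms in auto)
  define \<xi> where "\<xi> = w @- sconst j"
  \<comment> \<open>level 0 is not a cycle, and the letter \<open>j\<close> is appended from level \<open>length w\<close> on\<close>
  define n0 where "n0 = max 1 (length w)"
  define P where "P n = V (stake (n0 + n) \<xi>)" for n
  have n0: "1 \<le> n0" "length w \<le> n0" by (auto simp: n0_def)
  have X: "walk_connected X" and p: "p \<in> verts X"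
    and lim: "strong_GH_limit \<Gamma> (\<lambda>k. V (stake k \<xi>)) X p"
    using assms(5) walk_connected_if_connected_graph by (auto simp: is_sierp_limit_def \<xi>_def)
  have letters: "\<xi> !! m < r" for m
  proof (cases "m < length w")
    case True
    have "w ! m \<in> {..<r}" using assms(3) nth_mem[OF True] by (rule subsetD)
    then show ?thesis using True by (simp add: \<xi>_def)
  next
    case False
    then show ?thesis using assms(4) by (simp add: \<xi>_def shift_snth_ge)
  qed
  have stake_W: "stake k \<xi> \<in> W k" for k
    using letters by (auto simp: W_iff set_conv_nth)
  have P_Suc: "P (Suc n) = e (P n)" for n
  proof -
    have "\<xi> !! (n0 + n) = j" using n0 by (simp add: \<xi>_def shift_snth_ge)
    then have "stake (n0 + Suc n) \<xi> = stake (n0 + n) \<xi> @ [j]" using stake_Suc[of "n0 + n" \<xi>] by simp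
    then show ?thesis unfolding P_def using emb_V[OF stake_W j_less] by simp
  qed
  interpret pointed_tower "\<lambda>n. \<Gamma> (n0 + n)" e P
  proof unfold_locales
    fix n
    have pos: "1 \<le> n0 + n" using n0 by simp
    show "finite (verts (\<Gamma> (n0 + n)))" by (rule finite_verts_\<Gamma>)
    show "walk_connected (\<Gamma> (n0 + n))" using pos by (rule walk_connected_\<Gamma>)
    show "e x \<in> verts (\<Gamma> (n0 + Suc n))" if "x \<in> verts (\<Gamma> (n0 + n))" for x
      using emb_verts[OF that j_less] by simp
    show "gdist (\<Gamma> (n0 + Suc n)) (e x) (e y) = gdist (\<Gamma> (n0 + n)) x y"
      if "x \<in> verts (\<Gamma> (n0 + n))" "y \<in> verts (\<Gamma> (n0 + n))" for x y
      using emb_isometric[OF pos that j_less] by simp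
    show P_in: "P n \<in> verts (\<Gamma> (n0 + n))" for n unfolding P_def by (rule V_in_verts[OF stake_W])
    show "P (Suc n) = e (P n)" by (rule P_Suc)
    show "n < gdist (\<Gamma> (n0 + Suc n)) (P (Suc n)) v"
      if "v \<in> verts (\<Gamma> (n0 + Suc n))" "v \<notin> e ` verts (\<Gamma> (n0 + n))" for v
    proof -
      define q where "q k = P (k - n0)" for k
      have "n0 + n - n0 < gdist (\<Gamma> (Suc (n0 + n))) (q (Suc (n0 + n))) v"
      proof (rule escape[OF n0(1)])
        show "q k \<in> verts (\<Gamma> k)" if "n0 \<le> k" for k using P_in[of "k - n0"] that by (simp add: q_def)
        show "q (Suc k) = e (q k)" if "n0 \<le> k" for k using P_Suc[of "k - n0"] that by (simp add: q_def Suc_diff_le)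
      qed (use that in auto)
      then show ?thesis by (simp add: q_def Suc_diff_le)
    qed
  qed
  have lim': "\<exists>M. \<forall>m\<ge>M. \<exists>\<phi>.
      bij_betw \<phi> (gball (\<Gamma> (n0 + m)) (P m) (real R)) (gball X p (real R)) \<and>
      (\<forall>u\<in>gball (\<Gamma> (n0 + m)) (P m) (real R). \<forall>v\<in>gball (\<Gamma> (n0 + m)) (P m) (real R).
         gdist X (\<phi> u) (\<phi> v) = gdist (\<Gamma> (n0 + m)) u v) \<and> \<phi> (P m) = p" if "1 \<le> R" for R :: nat
  proof -
    have "real R > 0" using that by simp
    then obtain M where M: "\<forall>m>M. \<exists>\<phi>.
        bij_betw \<phi> (gball (\<Gamma> m) (V (stake m \<xi>)) (real R)) (gball X p (real R)) \<and>
        (\<forall>u\<in>gball (\<Gamma> m) (V (stake m \<xi>)) (real R). \<forall>v\<in>gball (\<Gamma> m) (V (stake m \<xi>)) (real R).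
           gdist X (\<phi> u) (\<phi> v) = gdist (\<Gamma> m) u v) \<and> \<phi> (V (stake m \<xi>)) = p"
      using lim unfolding strong_GH_limit_def by blast
    show ?thesis
      unfolding P_def
    proof (intro exI[of _ "Suc M"] allI impI)
      fix m assume "Suc M \<le> m"
      then have "M < n0 + m" by simp
      from M[rule_format, OF this] show "\<exists>\<phi>.
          bij_betw \<phi> (gball (\<Gamma> (n0 + m)) (V (stake (n0 + m) \<xi>)) (real R)) (gball X p (real R)) \<and>
          (\<forall>u\<in>gball (\<Gamma> (n0 + m)) (V (stake (n0 + m) \<xi>)) (real R).
             \<forall>v\<in>gball (\<Gamma> (n0 + m)) (V (stake (n0 + m) \<xi>)) (real R).
               gdist X (\<phi> u) (\<phi> v) = gdist (\<Gamma> (n0 + m)) u v) \<and> \<phi> (V (stake (n0 + m) \<xi>)) = p" .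
    qed
  qed
  obtain \<psi> where \<psi>: "\<And>n x. x \<in> verts (\<Gamma> (n0 + n)) \<Longrightarrow> \<psi> n x \<in> verts X"
    "\<And>n x y. x \<in> verts (\<Gamma> (n0 + n)) \<Longrightarrow> y \<in> verts (\<Gamma> (n0 + n)) \<Longrightarrow>
      gdist X (\<psi> n x) (\<psi> n y) = gdist (\<Gamma> (n0 + n)) x y"
    "\<And>n x. x \<in> verts (\<Gamma> (n0 + n)) \<Longrightarrow> \<psi> (Suc n) (e x) = \<psi> n x"
    "(\<Union>n. \<psi> n ` verts (\<Gamma> (n0 + n))) = verts X"
    by (rule limit_is_union[OF X p lim']) (assumption, rule that)
  have "two_gates X (\<lambda>n. \<psi> n ` verts (\<Gamma> (n0 + n))) (\<lambda>n. \<psi> n (gateA (n0 + n))) (\<lambda>n. \<psi> n (gateB (n0 + n)))"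
    by (rule two_gates_union[OF X n0(1) \<psi>])
  then interpret two_gates_based X "\<lambda>n. \<psi> n ` verts (\<Gamma> (n0 + n))" "\<lambda>n. \<psi> n (gateA (n0 + n))"
      "\<lambda>n. \<psi> n (gateB (n0 + n))" x0
    using assms(6) by (simp add: two_gates_based_def two_gates_based_axioms_def)
  show ?thesis
    using card_busemann_points countable_non_busemann_points infinite_non_busemann_points by blast
qed

end
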